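(* Let $\mathbf{C}$ be a dagger braided monoidal category. Then $\widehat{\mathbf{C}}=\mathrm{CP}^\infty(\mathbf{C})$, with the canonical functor $F\colon\mathbf{C}\to\widehat{\mathbf{C}}$ given by $A\mapsto A$ on objects and $f\mapsto[\lambda_B^\dagger f]$ on morphisms $f\colon A\to B$, and with $\top_A=[\rho_A^\dagger]\in\widehat{\mathbf{C}}(A,I)$ for each object $A$, is an environment structure for $\mathbf{C}$.
   Context: A dagger braided monoidal category is a braided monoidal category $\mathbf{C}$ with an identity-on-objects involutive contravariant functor $\dagger$ satisfying $(f\otimes g)^\dagger=f^\dagger\otimes g^\dagger$, whose coherence isomorphisms $\alpha_{A,B,C}\colon(A\otimes B)\otimes C\to A\otimes(B\otimes C)$, $\lambda_A\colon I\otimes A\to A$, $\rho_A\colon A\otimes I\to A$ and braiding $\sigma_{A,B}\colon A\otimes B\to B\otimes A$ are unitary. Associators and unitors are suppressed when convenient. Equivalence. For $f\colon A\to X\otimes B$ and $g\colon A\to X'\otimes B$ in $\mathbf{C}$ write $f\sim g$ ("$f$ and $g$ are equivalent") when $(f^\dagger\otimes 1_Y)(1_X\otimes h^\dagger h)(f\otimes 1_Y)=(g^\dagger\otimes 1_Y)(1_{X'}\otimes h^\dagger h)(g\otimes 1_Y)$ for all objects $Y,Z$ and all $h\colon B\otimes Y\to Z$ in $\mathbf{C}$. $\mathrm{CP}^\infty(\mathbf{C})$: objects are those of $\mathbf{C}$; morphisms $A\to B$ are $\sim$-classes $[f]$ of morphisms $f\colon A\to X\otimes B$, with $X$ any object;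 the identity on $A$ is $[\lambda_A^\dagger]$; for $f\colon A\to X\otimes B$, $g\colon B\to Y\otimes C$, $[g]\circ[f]=[\alpha_{X,Y,C}^\dagger(1_X\otimes g)f]$. It is monoidal with unit and tensor of objects as in $\mathbf{C}$, with $[f]\otimes[g]=[(1_X\otimes\sigma_{B,Y}\otimes 1_D)(f\otimes g)]$ for $f\colon A\to X\otimes B$, $g\colon C\to Y\otimes D$, and with coherence isomorphisms given by the classes $[\lambda^\dagger c]$ of the corresponding coherence isomorphisms $c$ of $\mathbf{C}$. In $\top_A=[\rho_A^\dagger]$, the morphism $\rho_A^\dagger\colon A\to A\otimes I$ is regarded as having ancillary object $X=A$ and codomain $I$. An environment structure for a dagger monoidal category $\mathbf{C}$ is a monoidal category $\widehat{\mathbf{C}}$ with the same objects, together with a strict monoidal functor $F\colon\mathbf{C}\to\widehat{\mathbf{C}}$ with $F(A)=A$, and for each object $A$ a morphism $\top_A\colon A\to I$ in $\widehat{\mathbf{C}}$, satisfying: (a) $\top_I=1_I$, and $\top_A\otimes\top_B=\top_{A\otimes B}$ (up to $I\otimes I\cong I$) for all objects $A$ and $B$; (b) for all $f\colon A\to X\otimes B$ and $g\colon A\to Y\otimes B$ in $\mathbf{C}$: $f\sim g$ if and only if $(\top_X\otimes 1_B)\circ F(f)=(\top_Y\otimes 1_B)\circ F(g)$ in $\widehat{\mathbf{C}}$ (up to $I\otimes B\cong B$); (c) for each $\widehat{f}\in\widehat{\mathbf{C}}(A,B)$ there are an object $X$ and $f\in\mathbf{C}(A,X\otimes B)$ such that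 $\widehat{f}=(\top_X\otimes 1_B)\circ F(f)$ in $\widehat{\mathbf{C}}$ (up to $I\otimes B\cong B$). *)

theory Defs
  imports Main
begin

text \<open>
  Every arrow has one domain and one codomain. The operations are total functions, and only their
  values on objects and on composable arrows are meaningful.
\<close>

record ('o, 'm) monoidal_structure =
  Obj :: "'o set"
  Arr :: "'m set"
  Dom :: "'m \<Rightarrow> 'o"
  Cod :: "'m \<Rightarrow> 'o"
  Ident :: "'o \<Rightarrow> 'm"  ("\<one>\<index>")
  Comp :: "'m \<Rightarrow> 'm \<Rightarrow> 'm"  (infixr "\<cdot>\<index>" 55)
  Unit :: "'o"  ("\<I>\<index>")
  TensorObj :: "'o \<Rightarrow> 'o \<Rightarrow> 'o"  (infixr "\<odot>\<index>" 65)
  TensorArr :: "'m \<Rightarrow> 'm \<Rightarrow> 'm"  (infixr "\<otimes>\<index>" 65)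
  Assoc :: "'o \<Rightarrow> 'o \<Rightarrow> 'o \<Rightarrow> 'm"  ("\<alpha>\<index>")
  LUnit :: "'o \<Rightarrow> 'm"  ("\<l>\<index>")
  RUnit :: "'o \<Rightarrow> 'm"  ("\<r>\<index>")

definition hom :: "('o, 'm, 'z) monoidal_structure_scheme \<Rightarrow> 'o \<Rightarrow> 'o \<Rightarrow> 'm set" where
  "hom C A B = {f \<in> Arr C. Dom C f = A \<and> Cod C f = B}"

definition inverse_arrows :: "('o, 'm, 'z) monoidal_structure_scheme \<Rightarrow> 'm \<Rightarrow> 'm \<Rightarrow> bool" where
  "inverse_arrows C f g \<longleftrightarrow>
     f \<in> Arr C \<and> g \<in> hom C (Cod C f) (Dom C f) \<and>
     g \<cdot>\<^bsub>C\<^esub> f = \<one>\<^bsub>C\<^esub> (Dom C f) \<and> f \<cdot>\<^bsub>C\<^esub> g = \<one>\<^bsub>C\<^esub> (Cod C f)"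

definition iso :: "('o, 'm, 'z) monoidal_structure_scheme \<Rightarrow> 'm \<Rightarrow> bool" where
  "iso C f \<longleftrightarrow> (\<exists>g. inverse_arrows C f g)"

definition inv_arr :: "('o, 'm, 'z) monoidal_structure_scheme \<Rightarrow> 'm \<Rightarrow> 'm" where
  "inv_arr C f = (THE g. inverse_arrows C f g)"

locale category =
  fixes C :: "('o, 'm, 'z) monoidal_structure_scheme" (structure)
  assumes Dom_Obj: "f \<in> Arr C \<Longrightarrow> Dom C f \<in> Obj C"
    and Cod_Obj: "f \<in> Arr C \<Longrightarrow> Cod C f \<in> Obj C"
    and Ident_hom: "A \<in> Obj C \<Longrightarrow> \<one> A \<in> hom C A A"
    and Comp_hom: "\<lbrakk>f \<in> hom C A B; g \<in> hom C B D\<rbrakk> \<Longrightarrow> g \<cdot> f \<in> hom C A D"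
    and Comp_Ident_left: "f \<in> hom C A B \<Longrightarrow> \<one> B \<cdot> f = f"
    and Comp_Ident_right: "f \<in> hom C A B \<Longrightarrow> f \<cdot> \<one> A = f"
    and Comp_assoc:
      "\<lbrakk>f \<in> hom C A B; g \<in> hom C B D; h \<in> hom C D E\<rbrakk> \<Longrightarrow> (h \<cdot> g) \<cdot> f = h \<cdot> (g \<cdot> f)"

locale monoidal_category = category C
  for C :: "('o, 'm, 'z) monoidal_structure_scheme" (structure) +
  assumes Unit_Obj: "\<I> \<in> Obj C"
    and TensorObj_Obj: "\<lbrakk>A \<in> Obj C; B \<in> Obj C\<rbrakk> \<Longrightarrow> A \<odot> B \<in> Obj C"
    and TensorArr_hom:
      "\<lbrakk>f \<in> hom C A B; g \<in> hom C A' B'\<rbrakk> \<Longrightarrow> f \<otimes> g \<in> hom C (A \<odot> A') (B \<odot> B')"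
    and TensorArr_Ident: "\<lbrakk>A \<in> Obj C; B \<in> Obj C\<rbrakk> \<Longrightarrow> \<one> A \<otimes> \<one> B = \<one> (A \<odot> B)"
    and interchange:
      "\<lbrakk>f \<in> hom C A B; g \<in> hom C B D; f' \<in> hom C A' B'; g' \<in> hom C B' D'\<rbrakk>
        \<Longrightarrow> (g \<cdot> f) \<otimes> (g' \<cdot> f') = (g \<otimes> g') \<cdot> (f \<otimes> f')"
    and Assoc_hom:
      "\<lbrakk>A \<in> Obj C; B \<in> Obj C; D \<in> Obj C\<rbrakk>
        \<Longrightarrow> \<alpha> A B D \<in> hom C ((A \<odot> B) \<odot> D) (A \<odot> (B \<odot> D))"
    and Assoc_iso: "\<lbrakk>A \<in> Obj C; B \<in> Obj C; D \<in> Obj C\<rbrakk> \<Longrightarrow> iso C (\<alpha> A B D)"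
    and Assoc_natural:
      "\<lbrakk>f \<in> hom C A A'; g \<in> hom C B B'; h \<in> hom C D D'\<rbrakk>
        \<Longrightarrow> \<alpha> A' B' D' \<cdot> ((f \<otimes> g) \<otimes> h) = (f \<otimes> (g \<otimes> h)) \<cdot> \<alpha> A B D"
    and LUnit_hom: "A \<in> Obj C \<Longrightarrow> \<l> A \<in> hom C (\<I> \<odot> A) A"
    and LUnit_iso: "A \<in> Obj C \<Longrightarrow> iso C (\<l> A)"
    and LUnit_natural: "f \<in> hom C A B \<Longrightarrow> \<l> B \<cdot> (\<one> \<I> \<otimes> f) = f \<cdot> \<l> A"
    and RUnit_hom: "A \<in> Obj C \<Longrightarrow> \<r> A \<in> hom C (A \<odot> \<I>) A"
    and RUnit_iso: "A \<in> Obj C \<Longrightarrow> iso C (\<r> A)"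
    and RUnit_natural: "f \<in> hom C A B \<Longrightarrow> \<r> B \<cdot> (f \<otimes> \<one> \<I>) = f \<cdot> \<r> A"
    and pentagon:
      "\<lbrakk>A \<in> Obj C; B \<in> Obj C; D \<in> Obj C; E \<in> Obj C\<rbrakk>
        \<Longrightarrow> \<alpha> A B (D \<odot> E) \<cdot> \<alpha> (A \<odot> B) D E =
            (\<one> A \<otimes> \<alpha> B D E) \<cdot> \<alpha> A (B \<odot> D) E \<cdot> (\<alpha> A B D \<otimes> \<one> E)"
    and triangle:
      "\<lbrakk>A \<in> Obj C; B \<in> Obj C\<rbrakk> \<Longrightarrow> (\<one> A \<otimes> \<l> B) \<cdot> \<alpha> A \<I> B = \<r> A \<otimes> \<one> B"

locale braided_monoidal_category = monoidal_category C
  for C :: "('o, 'm, 'z) monoidal_structure_scheme" (structure) +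
  fixes \<sigma> :: "'o \<Rightarrow> 'o \<Rightarrow> 'm"
  assumes braid_hom: "\<lbrakk>A \<in> Obj C; B \<in> Obj C\<rbrakk> \<Longrightarrow> \<sigma> A B \<in> hom C (A \<odot> B) (B \<odot> A)"
    and braid_iso: "\<lbrakk>A \<in> Obj C; B \<in> Obj C\<rbrakk> \<Longrightarrow> iso C (\<sigma> A B)"
    and braid_natural:
      "\<lbrakk>f \<in> hom C A A'; g \<in> hom C B B'\<rbrakk> \<Longrightarrow> \<sigma> A' B' \<cdot> (f \<otimes> g) = (g \<otimes> f) \<cdot> \<sigma> A B"
    and hexagon1:
      "\<lbrakk>A \<in> Obj C; B \<in> Obj C; D \<in> Obj C\<rbrakk>
        \<Longrightarrow> \<alpha> B D A \<cdot> \<sigma> A (B \<odot> D) \<cdot> \<alpha> A B D =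
            (\<one> B \<otimes> \<sigma> A D) \<cdot> \<alpha> B A D \<cdot> (\<sigma> A B \<otimes> \<one> D)"
    and hexagon2:
      "\<lbrakk>A \<in> Obj C; B \<in> Obj C; D \<in> Obj C\<rbrakk>
        \<Longrightarrow> inv_arr C (\<alpha> D A B) \<cdot> \<sigma> (A \<odot> B) D \<cdot> inv_arr C (\<alpha> A B D) =
            (\<sigma> A D \<otimes> \<one> B) \<cdot> inv_arr C (\<alpha> A D B) \<cdot> (\<one> A \<otimes> \<sigma> B D)"

definition unitary ::
  "('o, 'm, 'z) monoidal_structure_scheme \<Rightarrow> ('m \<Rightarrow> 'm) \<Rightarrow> 'm \<Rightarrow> bool" where
  "unitary C dag f \<longleftrightarrow> inverse_arrows C f (dag f)"

locale dagger_monoidal_category = monoidal_category C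
  for C :: "('o, 'm, 'z) monoidal_structure_scheme" (structure) +
  fixes dag :: "'m \<Rightarrow> 'm"
  assumes dag_hom: "f \<in> hom C A B \<Longrightarrow> dag f \<in> hom C B A"
    and dag_Ident: "A \<in> Obj C \<Longrightarrow> dag (\<one> A) = \<one> A"
    and dag_Comp: "\<lbrakk>f \<in> hom C A B; g \<in> hom C B D\<rbrakk> \<Longrightarrow> dag (g \<cdot> f) = dag f \<cdot> dag g"
    and dag_dag: "f \<in> Arr C \<Longrightarrow> dag (dag f) = f"
    and dag_TensorArr: "\<lbrakk>f \<in> Arr C; g \<in> Arr C\<rbrakk> \<Longrightarrow> dag (f \<otimes> g) = dag f \<otimes> dag g"
    and Assoc_unitary:
      "\<lbrakk>A \<in> Obj C; B \<in> Obj C; D \<in> Obj C\<rbrakk> \<Longrightarrow> unitary C dag (\<alpha> A B D)"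
    and LUnit_unitary: "A \<in> Obj C \<Longrightarrow> unitary C dag (\<l> A)"
    and RUnit_unitary: "A \<in> Obj C \<Longrightarrow> unitary C dag (\<r> A)"

locale dagger_braided_monoidal_category =
  dagger_monoidal_category C dag + braided_monoidal_category C \<sigma>
  for C :: "('o, 'm, 'z) monoidal_structure_scheme" (structure)
    and dag :: "'m \<Rightarrow> 'm" and \<sigma> :: "'o \<Rightarrow> 'o \<Rightarrow> 'm" +
  assumes braid_unitary: "\<lbrakk>A \<in> Obj C; B \<in> Obj C\<rbrakk> \<Longrightarrow> unitary C dag (\<sigma> A B)"

locale strict_monoidal_functor = C: monoidal_category C + D: monoidal_category D
  for C :: "('o, 'm, 'z) monoidal_structure_scheme"
    and D :: "('p, 'n, 'y) monoidal_structure_scheme" +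
  fixes Fo :: "'o \<Rightarrow> 'p" and Fm :: "'m \<Rightarrow> 'n"
  assumes F_Obj: "A \<in> Obj C \<Longrightarrow> Fo A \<in> Obj D"
    and F_hom: "f \<in> hom C A B \<Longrightarrow> Fm f \<in> hom D (Fo A) (Fo B)"
    and F_Ident: "A \<in> Obj C \<Longrightarrow> Fm (\<one>\<^bsub>C\<^esub> A) = \<one>\<^bsub>D\<^esub> (Fo A)"
    and F_Comp: "\<lbrakk>f \<in> hom C A B; g \<in> hom C B E\<rbrakk> \<Longrightarrow> Fm (g \<cdot>\<^bsub>C\<^esub> f) = Fm g \<cdot>\<^bsub>D\<^esub> Fm f"
    and F_Unit: "Fo \<I>\<^bsub>C\<^esub> = \<I>\<^bsub>D\<^esub>"
    and F_TensorObj: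
      "\<lbrakk>A \<in> Obj C; B \<in> Obj C\<rbrakk> \<Longrightarrow> Fo (A \<odot>\<^bsub>C\<^esub> B) = Fo A \<odot>\<^bsub>D\<^esub> Fo B"
    and F_TensorArr:
      "\<lbrakk>f \<in> Arr C; g \<in> Arr C\<rbrakk> \<Longrightarrow> Fm (f \<otimes>\<^bsub>C\<^esub> g) = Fm f \<otimes>\<^bsub>D\<^esub> Fm g"
    and F_Assoc:
      "\<lbrakk>A \<in> Obj C; B \<in> Obj C; E \<in> Obj C\<rbrakk>
        \<Longrightarrow> Fm (\<alpha>\<^bsub>C\<^esub> A B E) = \<alpha>\<^bsub>D\<^esub> (Fo A) (Fo B) (Fo E)"
    and F_LUnit: "A \<in> Obj C \<Longrightarrow> Fm (\<l>\<^bsub>C\<^esub> A) = \<l>\<^bsub>D\<^esub> (Fo A)"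
    and F_RUnit: "A \<in> Obj C \<Longrightarrow> Fm (\<r>\<^bsub>C\<^esub> A) = \<r>\<^bsub>D\<^esub> (Fo A)"

text \<open>
  For \<open>f : A \<rightarrow> X \<odot> B\<close> and \<open>h : B \<odot> Y \<rightarrow> Z\<close>, this is
  \<open>(f\<^sup>\<dagger> \<otimes> 1\<^sub>Y) (1\<^sub>X \<otimes> h\<^sup>\<dagger> h) (f \<otimes> 1\<^sub>Y) : A \<odot> Y \<rightarrow> A \<odot> Y\<close> with the associators
  \<open>(X \<odot> B) \<odot> Y \<rightarrow> X \<odot> (B \<odot> Y)\<close> made explicit.
\<close>

definition probe ::
  "('o, 'm, 'z) monoidal_structure_scheme \<Rightarrow> ('m \<Rightarrow> 'm) \<Rightarrow> 'o \<Rightarrow> 'o \<Rightarrow> 'o \<Rightarrow> 'm \<Rightarrow> 'm \<Rightarrow> 'm" where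
  "probe C dag B Y X f h =
     (dag f \<otimes>\<^bsub>C\<^esub> \<one>\<^bsub>C\<^esub> Y) \<cdot>\<^bsub>C\<^esub> dag (\<alpha>\<^bsub>C\<^esub> X B Y) \<cdot>\<^bsub>C\<^esub>
     (\<one>\<^bsub>C\<^esub> X \<otimes>\<^bsub>C\<^esub> (dag h \<cdot>\<^bsub>C\<^esub> h)) \<cdot>\<^bsub>C\<^esub> \<alpha>\<^bsub>C\<^esub> X B Y \<cdot>\<^bsub>C\<^esub> (f \<otimes>\<^bsub>C\<^esub> \<one>\<^bsub>C\<^esub> Y)"

definition anc_equiv ::
  "('o, 'm, 'z) monoidal_structure_scheme \<Rightarrow> ('m \<Rightarrow> 'm) \<Rightarrow> 'o \<Rightarrow> 'o \<times> 'm \<Rightarrow> 'o \<times> 'm \<Rightarrow> bool" where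
  "anc_equiv C dag B = (\<lambda>(X, f) (X', g).
     \<forall>Y \<in> Obj C. \<forall>Z \<in> Obj C. \<forall>h \<in> hom C (B \<odot>\<^bsub>C\<^esub> Y) Z.
       probe C dag B Y X f h = probe C dag B Y X' g h)"

text \<open>
  A morphism \<open>f : A \<rightarrow> X \<odot> B\<close> does not determine the pair \<open>(X, B)\<close> from its codomain, so
  the ancillary object is part of a representative, and an arrow of \<open>CP\<^sup>\<infinity>(C)\<close> is an
  equivalence class tagged with its domain and codomain.
\<close>

type_synonym ('o, 'm) cp_arr = "'o \<times> 'o \<times> ('o \<times> 'm) set"

definition cp_reps ::
  "('o, 'm, 'z) monoidal_structure_scheme \<Rightarrow> 'o \<Rightarrow> 'o \<Rightarrow> ('o \<times> 'm) set" where
  "cp_reps C A B = {(X, f). X \<in> Obj C \<and> f \<in> hom C A (X \<odot>\<^bsub>C\<^esub> B)}"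

definition cp_rel ::
  "('o, 'm, 'z) monoidal_structure_scheme \<Rightarrow> ('m \<Rightarrow> 'm) \<Rightarrow> 'o \<Rightarrow> 'o \<Rightarrow> ('o \<times> 'm) rel" where
  "cp_rel C dag A B =
     {(p, q). p \<in> cp_reps C A B \<and> q \<in> cp_reps C A B \<and> anc_equiv C dag B p q}"

definition cp_class ::
  "('o, 'm, 'z) monoidal_structure_scheme \<Rightarrow> ('m \<Rightarrow> 'm) \<Rightarrow> 'o \<Rightarrow> 'o \<Rightarrow> 'o \<Rightarrow> 'm
    \<Rightarrow> ('o, 'm) cp_arr" where
  "cp_class C dag A B X f = (A, B, cp_rel C dag A B `` {(X, f)})"

definition cp_embed ::
  "('o, 'm, 'z) monoidal_structure_scheme \<Rightarrow> ('m \<Rightarrow> 'm) \<Rightarrow> 'm \<Rightarrow> ('o, 'm) cp_arr" where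
  "cp_embed C dag f =
     cp_class C dag (Dom C f) (Cod C f) \<I>\<^bsub>C\<^esub> (dag (\<l>\<^bsub>C\<^esub> (Cod C f)) \<cdot>\<^bsub>C\<^esub> f)"

text \<open>
  The operations on classes are unions over all representatives, as for \<open>UN_equiv_class2\<close>: the
  union is again a class only if the operation on representatives respects the equivalence.
\<close>

definition cp_comp ::
  "('o, 'm, 'z) monoidal_structure_scheme \<Rightarrow> ('m \<Rightarrow> 'm)
    \<Rightarrow> ('o, 'm) cp_arr \<Rightarrow> ('o, 'm) cp_arr \<Rightarrow> ('o, 'm) cp_arr" where
  "cp_comp C dag = (\<lambda>(B', D, G) (A, B, F).
     (A, D, \<Union>(X, f) \<in> F. \<Union>(Y, g) \<in> G.
        cp_rel C dag A D ``
          {(X \<odot>\<^bsub>C\<^esub> Y, dag (\<alpha>\<^bsub>C\<^esub> X Y D) \<cdot>\<^bsub>C\<^esub> (\<one>\<^bsub>C\<^esub> X \<otimes>\<^bsub>C\<^esub> g) \<cdot>\<^bsub>C\<^esub> f)}))"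

text \<open>
  This is \<open>1\<^sub>X \<otimes> \<sigma>\<^sub>B\<^sub>,\<^sub>Y \<otimes> 1\<^sub>D\<close> with explicit associators, from
  \<open>(X \<odot> B) \<odot> (Y \<odot> D)\<close> to \<open>(X \<odot> Y) \<odot> (B \<odot> D)\<close>.
\<close>

definition middle_braid ::
  "('o, 'm, 'z) monoidal_structure_scheme \<Rightarrow> ('m \<Rightarrow> 'm) \<Rightarrow> ('o \<Rightarrow> 'o \<Rightarrow> 'm)
    \<Rightarrow> 'o \<Rightarrow> 'o \<Rightarrow> 'o \<Rightarrow> 'o \<Rightarrow> 'm" where
  "middle_braid C dag \<sigma> X B Y D =
     dag (\<alpha>\<^bsub>C\<^esub> X Y (B \<odot>\<^bsub>C\<^esub> D)) \<cdot>\<^bsub>C\<^esub>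
     (\<one>\<^bsub>C\<^esub> X \<otimes>\<^bsub>C\<^esub> (\<alpha>\<^bsub>C\<^esub> Y B D \<cdot>\<^bsub>C\<^esub> (\<sigma> B Y \<otimes>\<^bsub>C\<^esub> \<one>\<^bsub>C\<^esub> D) \<cdot>\<^bsub>C\<^esub> dag (\<alpha>\<^bsub>C\<^esub> B Y D))) \<cdot>\<^bsub>C\<^esub>
     \<alpha>\<^bsub>C\<^esub> X B (Y \<odot>\<^bsub>C\<^esub> D)"

definition cp_tensor ::
  "('o, 'm, 'z) monoidal_structure_scheme \<Rightarrow> ('m \<Rightarrow> 'm) \<Rightarrow> ('o \<Rightarrow> 'o \<Rightarrow> 'm)
    \<Rightarrow> ('o, 'm) cp_arr \<Rightarrow> ('o, 'm) cp_arr \<Rightarrow> ('o, 'm) cp_arr" where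
  "cp_tensor C dag \<sigma> = (\<lambda>(A, B, F) (A', D, G).
     (A \<odot>\<^bsub>C\<^esub> A', B \<odot>\<^bsub>C\<^esub> D, \<Union>(X, f) \<in> F. \<Union>(Y, g) \<in> G.
        cp_rel C dag (A \<odot>\<^bsub>C\<^esub> A') (B \<odot>\<^bsub>C\<^esub> D) ``
          {(X \<odot>\<^bsub>C\<^esub> Y, middle_braid C dag \<sigma> X B Y D \<cdot>\<^bsub>C\<^esub> (f \<otimes>\<^bsub>C\<^esub> g))}))"

definition CP_inf ::
  "('o, 'm, 'z) monoidal_structure_scheme \<Rightarrow> ('m \<Rightarrow> 'm) \<Rightarrow> ('o \<Rightarrow> 'o \<Rightarrow> 'm)
    \<Rightarrow> ('o, ('o, 'm) cp_arr) monoidal_structure" where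
  "CP_inf C dag \<sigma> = \<lparr>
     Obj = Obj C,
     Arr = {(A, B, F). A \<in> Obj C \<and> B \<in> Obj C \<and> F \<in> cp_reps C A B // cp_rel C dag A B},
     Dom = (\<lambda>(A, B, F). A),
     Cod = (\<lambda>(A, B, F). B),
     Ident = (\<lambda>A. cp_class C dag A A \<I>\<^bsub>C\<^esub> (dag (\<l>\<^bsub>C\<^esub> A))),
     Comp = cp_comp C dag,
     Unit = \<I>\<^bsub>C\<^esub>,
     TensorObj = (\<lambda>A B. A \<odot>\<^bsub>C\<^esub> B),
     TensorArr = cp_tensor C dag \<sigma>,
     Assoc = (\<lambda>A B D. cp_embed C dag (\<alpha>\<^bsub>C\<^esub> A B D)),
     LUnit = (\<lambda>A. cp_embed C dag (\<l>\<^bsub>C\<^esub> A)),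
     RUnit = (\<lambda>A. cp_embed C dag (\<r>\<^bsub>C\<^esub> A)) \<rparr>"

text \<open>
  The isomorphisms \<open>I \<odot> B \<cong> B\<close> up to which the axioms hold are the left unitors of \<open>D\<close>.
\<close>

locale environment_structure =
  dagger_monoidal_category C dag + strict_monoidal_functor C D Fo Fm
  for C :: "('o, 'm, 'z) monoidal_structure_scheme"
    and dag :: "'m \<Rightarrow> 'm"
    and D :: "('o, 'n, 'y) monoidal_structure_scheme"
    and Fo :: "'o \<Rightarrow> 'o" and Fm :: "'m \<Rightarrow> 'n" +
  fixes top :: "'o \<Rightarrow> 'n"
  assumes Obj_eq: "Obj D = Obj C"
    and F_Obj_eq: "A \<in> Obj C \<Longrightarrow> Fo A = A"
    and top_hom: "A \<in> Obj C \<Longrightarrow> top A \<in> hom D A \<I>\<^bsub>D\<^esub>"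
    and top_Unit: "top \<I>\<^bsub>D\<^esub> = \<one>\<^bsub>D\<^esub> \<I>\<^bsub>D\<^esub>"
    and top_TensorObj:
      "\<lbrakk>A \<in> Obj C; B \<in> Obj C\<rbrakk>
        \<Longrightarrow> \<l>\<^bsub>D\<^esub> \<I>\<^bsub>D\<^esub> \<cdot>\<^bsub>D\<^esub> (top A \<otimes>\<^bsub>D\<^esub> top B) = top (A \<odot>\<^bsub>D\<^esub> B)"
    and anc_equiv_iff:
      "\<lbrakk>A \<in> Obj C; B \<in> Obj C; X \<in> Obj C; Y \<in> Obj C;
        f \<in> hom C A (X \<odot>\<^bsub>C\<^esub> B); g \<in> hom C A (Y \<odot>\<^bsub>C\<^esub> B)\<rbrakk>
        \<Longrightarrow> anc_equiv C dag B (X, f) (Y, g) \<longleftrightarrow>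
            \<l>\<^bsub>D\<^esub> B \<cdot>\<^bsub>D\<^esub> (top X \<otimes>\<^bsub>D\<^esub> \<one>\<^bsub>D\<^esub> B) \<cdot>\<^bsub>D\<^esub> Fm f =
            \<l>\<^bsub>D\<^esub> B \<cdot>\<^bsub>D\<^esub> (top Y \<otimes>\<^bsub>D\<^esub> \<one>\<^bsub>D\<^esub> B) \<cdot>\<^bsub>D\<^esub> Fm g"
    and purification:
      "\<lbrakk>A \<in> Obj C; B \<in> Obj C; k \<in> hom D A B\<rbrakk>
        \<Longrightarrow> \<exists>X \<in> Obj C. \<exists>f \<in> hom C A (X \<odot>\<^bsub>C\<^esub> B).
              k = \<l>\<^bsub>D\<^esub> B \<cdot>\<^bsub>D\<^esub> (top X \<otimes>\<^bsub>D\<^esub> \<one>\<^bsub>D\<^esub> B) \<cdot>\<^bsub>D\<^esub> Fm f"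

end

theory Submission
  imports Defs
begin

text \<open>
  Write \<open>K = \<alpha> \<cdot> (f \<otimes> 1\<^sub>Y)\<close> for \<open>f : A \<rightarrow> X \<odot> B\<close> and \<open>T\<^sub>f(p) = K\<^sup>\<dagger> (1\<^sub>X \<otimes> p) K\<close> (\<open>pull\<close> below).
  Then \<open>f \<sim> g\<close> means that \<open>T\<^sub>f\<close> and \<open>T\<^sub>g\<close> agree on all \<open>p = h\<^sup>\<dagger> h\<close>, so a class \<open>[f]\<close> is determined by the
  family \<open>T\<^sub>f\<close>, natural in \<open>Y\<close>. Composition of classes becomes composition of
  functions in the reverse order, which makes well-definedness and the category laws immediate.

  Tensoring on the right with \<open>W\<close> amounts to evaluating \<open>T\<^sub>f\<close> at \<open>W \<odot> Y\<close>; tensoring on the left is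
  defined from it by conjugating with the braiding. The tensor of two classes is
  \<open>(1 \<otimes> [g]) \<circ> ([f] \<otimes> 1)\<close>, on representatives even literally so by a hexagon. The other order gives
  the same up to the unitary \<open>\<sigma>\<^sub>X\<^sub>,\<^sub>W\<close> on the ancilla, which \<open>\<sim>\<close> does not see, and this is the interchange
  law. Naturality of the associator reduces to whiskerings, where it is the pentagon and the two hexagons.
  Finally \<open>(\<top>\<^sub>X \<otimes> 1\<^sub>B) \<circ> F(f) = [f]\<close>, which gives the environment axioms.
\<close>

subsection \<open>Simplification in monoidal and dagger categories\<close>

context category
begin

text \<open>Typing by \<open>hom\<close> is replaced by equations on \<open>Dom\<close> and
  \<open>Cod\<close>, which the simplifier can discharge while it normalises composites.\<close>

lemma hom_iff [simp]: "f \<in> hom C A B \<longleftrightarrow> f \<in> Arr C \<and> Dom C f = A \<and> Cod C f = B"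
  by (simp add: hom_def)

lemma Dom_Cod_Obj [simp]: "f \<in> Arr C \<Longrightarrow> Dom C f \<in> Obj C" "f \<in> Arr C \<Longrightarrow> Cod C f \<in> Obj C"
  by (simp_all add: Dom_Obj Cod_Obj)

lemma Ident_simps [simp]:
  assumes "A \<in> Obj C"
  shows "\<one> A \<in> Arr C" "Dom C (\<one> A) = A" "Cod C (\<one> A) = A"
  using Ident_hom [OF assms] by simp_all

lemma Comp_simps [simp]:
  assumes "f \<in> Arr C" "g \<in> Arr C" "Dom C g = Cod C f"
  shows "g \<cdot> f \<in> Arr C" "Dom C (g \<cdot> f) = Dom C f" "Cod C (g \<cdot> f) = Cod C g"
  using Comp_hom [of f "Dom C f" "Cod C f" g "Cod C g"] assms by simp_all

lemma Comp_Ident [simp]: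
  assumes "f \<in> Arr C"
  shows "Cod C f = B \<Longrightarrow> \<one> B \<cdot> f = f" "Dom C f = A \<Longrightarrow> f \<cdot> \<one> A = f"
  using assms Comp_Ident_left Comp_Ident_right by auto

lemma Comp_assoc_simp [simp]:
  assumes "f \<in> Arr C" "g \<in> Arr C" "h \<in> Arr C" "Dom C g = Cod C f" "Dom C h = Cod C g"
  shows "(h \<cdot> g) \<cdot> f = h \<cdot> (g \<cdot> f)"
  using Comp_assoc [of f "Dom C f" "Cod C f" g "Cod C g" h "Cod C h"] assms by simp

text \<open>Composites are normalised to right-nested form, where a rule with left side
  \<open>g \<cdot> f\<close> does not match in front of a further factor \<open>h\<close>. This
  supplies the instance with that factor.\<close>

lemma Comp_reassoc:
  assumes "g \<cdot> f = k" "f \<in> Arr C" "g \<in> Arr C" "h \<in> Arr C" "Dom C g = Cod C f" "Cod C h = Dom C f"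
  shows "g \<cdot> (f \<cdot> h) = k \<cdot> h"
  using assms by (metis Comp_assoc_simp)

lemma inverse_arrows_unique:
  assumes "inverse_arrows C f g" "inverse_arrows C f g'"
  shows "g = g'"
  using assms Comp_assoc_simp [of g' f g] Comp_Ident [of g] Comp_Ident [of g']
  by (simp add: inverse_arrows_def del: Comp_assoc_simp)

lemma inv_arr_eq: "inverse_arrows C f g \<Longrightarrow> inv_arr C f = g"
  unfolding inv_arr_def using inverse_arrows_unique by blast

end

context monoidal_category
begin

lemma Obj_simps [simp]: "\<I> \<in> Obj C" "\<lbrakk>A \<in> Obj C; B \<in> Obj C\<rbrakk> \<Longrightarrow> A \<odot> B \<in> Obj C"
  by (simp_all add: Unit_Obj TensorObj_Obj)

lemma Tensor_simps [simp]:
  assumes "f \<in> Arr C" "g \<in> Arr C"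
  shows "f \<otimes> g \<in> Arr C" "Dom C (f \<otimes> g) = Dom C f \<odot> Dom C g" "Cod C (f \<otimes> g) = Cod C f \<odot> Cod C g"
  using TensorArr_hom [of f "Dom C f" "Cod C f" g "Dom C g" "Cod C g"] assms by simp_all

lemma Tensor_Ident [simp]: "\<lbrakk>A \<in> Obj C; B \<in> Obj C\<rbrakk> \<Longrightarrow> \<one> A \<otimes> \<one> B = \<one> (A \<odot> B)"
  by (rule TensorArr_Ident)

lemma Tensor_Comp [simp]:
  assumes "f \<in> Arr C" "g \<in> Arr C" "f' \<in> Arr C" "g' \<in> Arr C" "Dom C g = Cod C f" "Dom C g' = Cod C f'"
  shows "(g \<otimes> g') \<cdot> (f \<otimes> f') = (g \<cdot> f) \<otimes> (g' \<cdot> f')"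
  using interchange [of f "Dom C f" "Cod C f" g "Cod C g" f' "Dom C f'" "Cod C f'" g' "Cod C g'"] assms
  by simp

lemma Tensor_Comp_Comp [simp]:
  assumes "f \<in> Arr C" "g \<in> Arr C" "f' \<in> Arr C" "g' \<in> Arr C" "Dom C g = Cod C f" "Dom C g' = Cod C f'"
    and "h \<in> Arr C" "Cod C h = Dom C f \<odot> Dom C f'"
  shows "(g \<otimes> g') \<cdot> (f \<otimes> f') \<cdot> h = ((g \<cdot> f) \<otimes> (g' \<cdot> f')) \<cdot> h"
  by (rule Comp_reassoc) (use assms in simp_all)

lemma coherence_simps [simp]:
  "\<lbrakk>A \<in> Obj C; B \<in> Obj C; D \<in> Obj C\<rbrakk> \<Longrightarrow> \<alpha> A B D \<in> Arr C"
  "\<lbrakk>A \<in> Obj C; B \<in> Obj C; D \<in> Obj C\<rbrakk> \<Longrightarrow> Dom C (\<alpha> A B D) = (A \<odot> B) \<odot> D"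
  "\<lbrakk>A \<in> Obj C; B \<in> Obj C; D \<in> Obj C\<rbrakk> \<Longrightarrow> Cod C (\<alpha> A B D) = A \<odot> (B \<odot> D)"
  "A \<in> Obj C \<Longrightarrow> \<l> A \<in> Arr C" "A \<in> Obj C \<Longrightarrow> Dom C (\<l> A) = \<I> \<odot> A" "A \<in> Obj C \<Longrightarrow> Cod C (\<l> A) = A"
  "A \<in> Obj C \<Longrightarrow> \<r> A \<in> Arr C" "A \<in> Obj C \<Longrightarrow> Dom C (\<r> A) = A \<odot> \<I>" "A \<in> Obj C \<Longrightarrow> Cod C (\<r> A) = A"
  using Assoc_hom [of A B D] LUnit_hom [of A] RUnit_hom [of A] by simp_all

lemma Assoc_nat:
  assumes "f \<in> Arr C" "g \<in> Arr C" "h \<in> Arr C" "Cod C f = A'" "Cod C g = B'" "Cod C h = D'"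
  shows "\<alpha> A' B' D' \<cdot> ((f \<otimes> g) \<otimes> h) = (f \<otimes> (g \<otimes> h)) \<cdot> \<alpha> (Dom C f) (Dom C g) (Dom C h)"
  using Assoc_natural [of f "Dom C f" A' g "Dom C g" B' h "Dom C h" D'] assms by simp

lemma LUnit_nat:
  assumes "f \<in> Arr C" "Cod C f = B"
  shows "\<l> B \<cdot> (\<one> \<I> \<otimes> f) = f \<cdot> \<l> (Dom C f)"
  using LUnit_natural [of f "Dom C f" B] assms by simp

lemma RUnit_nat:
  assumes "f \<in> Arr C" "Cod C f = B"
  shows "\<r> B \<cdot> (f \<otimes> \<one> \<I>) = f \<cdot> \<r> (Dom C f)"
  using RUnit_natural [of f "Dom C f" B] assms by simp

end

context dagger_monoidal_category
begin

lemma dag_simps [simp]: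
  assumes "f \<in> Arr C"
  shows "dag f \<in> Arr C" "Dom C (dag f) = Cod C f" "Cod C (dag f) = Dom C f" "dag (dag f) = f"
  using dag_hom [of f "Dom C f" "Cod C f"] dag_dag assms by simp_all

lemma dag_Comp_simp [simp]:
  assumes "f \<in> Arr C" "g \<in> Arr C" "Dom C g = Cod C f"
  shows "dag (g \<cdot> f) = dag f \<cdot> dag g"
  using dag_Comp [of f "Dom C f" "Cod C f" g "Cod C g"] assms by simp

lemma dag_Ident_Tensor [simp]:
  "A \<in> Obj C \<Longrightarrow> dag (\<one> A) = \<one> A"
  "\<lbrakk>f \<in> Arr C; g \<in> Arr C\<rbrakk> \<Longrightarrow> dag (f \<otimes> g) = dag f \<otimes> dag g"
  by (simp_all add: dag_Ident dag_TensorArr)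

lemma unitary_cancel:
  assumes "unitary C dag u"
  shows "dag u \<cdot> u = \<one> (Dom C u)" "u \<cdot> dag u = \<one> (Cod C u)"
    "\<lbrakk>h \<in> Arr C; Cod C h = Dom C u\<rbrakk> \<Longrightarrow> dag u \<cdot> u \<cdot> h = h"
    "\<lbrakk>h \<in> Arr C; Cod C h = Cod C u\<rbrakk> \<Longrightarrow> u \<cdot> dag u \<cdot> h = h"
proof -
  have u: "u \<in> Arr C" and 1: "dag u \<cdot> u = \<one> (Dom C u)" and 2: "u \<cdot> dag u = \<one> (Cod C u)"
    using assms by (auto simp: unitary_def inverse_arrows_def)
  show "dag u \<cdot> u = \<one> (Dom C u)" "u \<cdot> dag u = \<one> (Cod C u)" by fact+
  show "dag u \<cdot> u \<cdot> h = h" if "h \<in> Arr C" "Cod C h = Dom C u"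
    using Comp_reassoc [OF 1, of h] u that by simp
  show "u \<cdot> dag u \<cdot> h = h" if "h \<in> Arr C" "Cod C h = Cod C u"
    using Comp_reassoc [OF 2, of h] u that by simp
qed

lemma coherence_cancel [simp]:
  assumes "A \<in> Obj C"
  shows "dag (\<l> A) \<cdot> \<l> A = \<one> (\<I> \<odot> A)" "\<l> A \<cdot> dag (\<l> A) = \<one> A"
    "\<lbrakk>h \<in> Arr C; Cod C h = \<I> \<odot> A\<rbrakk> \<Longrightarrow> dag (\<l> A) \<cdot> \<l> A \<cdot> h = h"
    "\<lbrakk>h \<in> Arr C; Cod C h = A\<rbrakk> \<Longrightarrow> \<l> A \<cdot> dag (\<l> A) \<cdot> h = h"
    "dag (\<r> A) \<cdot> \<r> A = \<one> (A \<odot> \<I>)" "\<r> A \<cdot> dag (\<r> A) = \<one> A"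
    "\<lbrakk>h \<in> Arr C; Cod C h = A \<odot> \<I>\<rbrakk> \<Longrightarrow> dag (\<r> A) \<cdot> \<r> A \<cdot> h = h"
    "\<lbrakk>h \<in> Arr C; Cod C h = A\<rbrakk> \<Longrightarrow> \<r> A \<cdot> dag (\<r> A) \<cdot> h = h"
  using assms unitary_cancel [OF LUnit_unitary] unitary_cancel [OF RUnit_unitary] by simp_all

lemma Assoc_cancel [simp]:
  assumes "A \<in> Obj C" "B \<in> Obj C" "D \<in> Obj C"
  shows "dag (\<alpha> A B D) \<cdot> \<alpha> A B D = \<one> ((A \<odot> B) \<odot> D)"
    "\<alpha> A B D \<cdot> dag (\<alpha> A B D) = \<one> (A \<odot> (B \<odot> D))"
    "\<lbrakk>h \<in> Arr C; Cod C h = (A \<odot> B) \<odot> D\<rbrakk> \<Longrightarrow> dag (\<alpha> A B D) \<cdot> \<alpha> A B D \<cdot> h = h"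
    "\<lbrakk>h \<in> Arr C; Cod C h = A \<odot> (B \<odot> D)\<rbrakk> \<Longrightarrow> \<alpha> A B D \<cdot> dag (\<alpha> A B D) \<cdot> h = h"
  using assms unitary_cancel [OF Assoc_unitary] by simp_all

text \<open>The second hexagon is stated with \<open>inv_arr\<close>. By unitarity these inverses
  are daggers, so that later calculations involve \<open>dag\<close> alone.\<close>

lemma inv_arr_Assoc: "\<lbrakk>A \<in> Obj C; B \<in> Obj C; D \<in> Obj C\<rbrakk> \<Longrightarrow> inv_arr C (\<alpha> A B D) = dag (\<alpha> A B D)"
  using Assoc_unitary by (simp add: unitary_def inv_arr_eq)

lemma Assoc_nat_Comp:
  assumes "f \<in> Arr C" "g \<in> Arr C" "h \<in> Arr C" "Cod C f = A'" "Cod C g = B'" "Cod C h = D'"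
    and "k \<in> Arr C" "Cod C k = (Dom C f \<odot> Dom C g) \<odot> Dom C h"
  shows "\<alpha> A' B' D' \<cdot> ((f \<otimes> g) \<otimes> h) \<cdot> k
    = (f \<otimes> (g \<otimes> h)) \<cdot> \<alpha> (Dom C f) (Dom C g) (Dom C h) \<cdot> k"
  using Comp_reassoc [OF Assoc_nat [of f g h A' B' D'], of k] assms by auto

text \<open>The pentagon with two associators moved across by unitarity. Its left side arises when a
  representative rebracketed by \<open>dag (\<alpha> A B D)\<close> is dilated.\<close>

lemma pentagon_dag:
  assumes "A \<in> Obj C" "B \<in> Obj C" "D \<in> Obj C" "E \<in> Obj C"
  shows "\<alpha> (A \<odot> B) D E \<cdot> (dag (\<alpha> A B D) \<otimes> \<one> E)
    = dag (\<alpha> A B (D \<odot> E)) \<cdot> (\<one> A \<otimes> \<alpha> B D E) \<cdot> \<alpha> A (B \<odot> D) E"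
proof -
  have "\<alpha> (A \<odot> B) D E = dag (\<alpha> A B (D \<odot> E)) \<cdot> \<alpha> A B (D \<odot> E) \<cdot> \<alpha> (A \<odot> B) D E"
    using assms by simp
  also have "\<dots> = dag (\<alpha> A B (D \<odot> E)) \<cdot> (\<one> A \<otimes> \<alpha> B D E) \<cdot> \<alpha> A (B \<odot> D) E \<cdot> (\<alpha> A B D \<otimes> \<one> E)"
    using assms by (simp add: pentagon)
  finally show ?thesis
    using assms by simp
qed

lemma pentagon_dag':
  assumes "A \<in> Obj C" "B \<in> Obj C" "D \<in> Obj C" "E \<in> Obj C"
  shows "(\<alpha> A B D \<otimes> \<one> E) \<cdot> dag (\<alpha> (A \<odot> B) D E)
    = dag (\<alpha> A (B \<odot> D) E) \<cdot> (\<one> A \<otimes> dag (\<alpha> B D E)) \<cdot> \<alpha> A B (D \<odot> E)"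
  using arg_cong [OF pentagon_dag [OF assms], of dag] assms by simp

text \<open>By naturality of the left unitor, conjugating \<open>\<one> \<I> \<otimes> f\<close>
  with unitors recovers \<open>f\<close>.\<close>

lemma Unit_Tensor_cancel:
  assumes "\<one> \<I> \<otimes> f = \<one> \<I> \<otimes> g" "f \<in> Arr C" "g \<in> Arr C" "Dom C f = Dom C g" "Cod C f = Cod C g"
  shows "f = g"
proof -
  have "f = \<l> (Cod C f) \<cdot> (\<one> \<I> \<otimes> f) \<cdot> dag (\<l> (Dom C f))"
    using assms(2) Comp_reassoc [OF LUnit_nat [of f "Cod C f"], of "dag (\<l> (Dom C f))"] by simp
  also have "\<dots> = g"
    using assms Comp_reassoc [OF LUnit_nat [of g "Cod C g"], of "dag (\<l> (Dom C g))"] by simp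
  finally show ?thesis .
qed

text \<open>Kelly's argument: tensoring with the unit is faithful, and \<open>\<one> \<I> \<otimes> _\<close> of both sides agree by
  the pentagon for \<open>\<I>, \<I>, A, B\<close> and two triangles.\<close>

lemma LUnit_Tensor:
  assumes "A \<in> Obj C" "B \<in> Obj C"
  shows "\<l> (A \<odot> B) \<cdot> \<alpha> \<I> A B = \<l> A \<otimes> \<one> B"
proof (rule Unit_Tensor_cancel)
  \<comment> \<open>Both sides are compared after precomposition with \<open>a\<close>, the last two
    factors on the right of the pentagon. Its inverse \<open>b\<close> removes it again at the
    end.\<close>
  define a where "a = \<alpha> \<I> (\<I> \<odot> A) B \<cdot> (\<alpha> \<I> \<I> A \<otimes> \<one> B)"
  define b where "b = (dag (\<alpha> \<I> \<I> A) \<otimes> \<one> B) \<cdot> dag (\<alpha> \<I> (\<I> \<odot> A) B)"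
  have ab: "a \<cdot> b = \<one> (\<I> \<odot> ((\<I> \<odot> A) \<odot> B))"
    and [simp]: "a \<in> Arr C" "Cod C a = \<I> \<odot> ((\<I> \<odot> A) \<odot> B)" "b \<in> Arr C" "Cod C b = Dom C a"
      "Dom C b = \<I> \<odot> ((\<I> \<odot> A) \<odot> B)"
    using assms by (simp_all add: a_def b_def)
  have "(\<one> \<I> \<otimes> (\<l> (A \<odot> B) \<cdot> \<alpha> \<I> A B)) \<cdot> a
      = (\<one> \<I> \<otimes> \<l> (A \<odot> B)) \<cdot> ((\<one> \<I> \<otimes> \<alpha> \<I> A B) \<cdot> \<alpha> \<I> (\<I> \<odot> A) B \<cdot> (\<alpha> \<I> \<I> A \<otimes> \<one> B))"
    using assms by (simp add: a_def)
  also have "\<dots> = (\<one> \<I> \<otimes> \<l> (A \<odot> B)) \<cdot> \<alpha> \<I> \<I> (A \<odot> B) \<cdot> \<alpha> (\<I> \<odot> \<I>) A B"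
    using assms by (simp add: pentagon)
  also have "\<dots> = (\<r> \<I> \<otimes> \<one> (A \<odot> B)) \<cdot> \<alpha> (\<I> \<odot> \<I>) A B"
    using assms Comp_reassoc [OF triangle [of \<I> "A \<odot> B"], of "\<alpha> (\<I> \<odot> \<I>) A B"] by simp
  also have "\<dots> = \<alpha> \<I> A B \<cdot> ((\<r> \<I> \<otimes> \<one> A) \<otimes> \<one> B)"
    using assms Assoc_nat [of "\<r> \<I>" "\<one> A" "\<one> B"] by simp
  also have "\<dots> = \<alpha> \<I> A B \<cdot> ((\<one> \<I> \<otimes> \<l> A) \<otimes> \<one> B) \<cdot> (\<alpha> \<I> \<I> A \<otimes> \<one> B)"
    using assms by (simp add: triangle)
  also have "\<dots> = (\<one> \<I> \<otimes> (\<l> A \<otimes> \<one> B)) \<cdot> a"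
    using assms by (simp add: a_def Assoc_nat_Comp del: Tensor_Comp)
  finally have "((\<one> \<I> \<otimes> (\<l> (A \<odot> B) \<cdot> \<alpha> \<I> A B)) \<cdot> a) \<cdot> b = ((\<one> \<I> \<otimes> (\<l> A \<otimes> \<one> B)) \<cdot> a) \<cdot> b"
    by (rule arg_cong)
  then show "\<one> \<I> \<otimes> (\<l> (A \<odot> B) \<cdot> \<alpha> \<I> A B) = \<one> \<I> \<otimes> (\<l> A \<otimes> \<one> B)"
    using assms by (simp add: ab)
qed (use assms in simp_all)

subsection \<open>Equivalence as an action on positive endomorphisms\<close>

text \<open>The map \<open>K\<close> of the introduction. The associator separates the ancilla
  \<open>X\<close> from \<open>B \<odot> Y\<close>, on which the tested endomorphism acts.\<close>

definition dilation :: "'o \<Rightarrow> 'o \<Rightarrow> 'm \<Rightarrow> 'o \<Rightarrow> 'm" where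
  "dilation X B f Y = \<alpha> X B Y \<cdot> (f \<otimes> \<one> Y)"

definition pull :: "'o \<Rightarrow> 'o \<Rightarrow> 'm \<Rightarrow> 'o \<Rightarrow> 'm \<Rightarrow> 'm" where
  "pull X B f Y p = dag (dilation X B f Y) \<cdot> (\<one> X \<otimes> p) \<cdot> dilation X B f Y"

text \<open>The endomorphisms that the equivalence tests. They are closed under conjugation and
  under \<open>\<one> X \<otimes> _\<close>, so a pull of one is again one and pulls can be
  iterated.\<close>

definition pos :: "'o \<Rightarrow> 'm set" where
  "pos A = {dag h \<cdot> h | h. h \<in> Arr C \<and> Dom C h = A}"

lemma pos_Arr: "p \<in> pos A \<Longrightarrow> p \<in> Arr C \<and> Dom C p = A \<and> Cod C p = A"
  by (auto simp: pos_def)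

lemma pos_conj:
  assumes "p \<in> pos A" "u \<in> Arr C" "Cod C u = A" "Dom C u = B"
  shows "dag u \<cdot> p \<cdot> u \<in> pos B"
proof -
  obtain h where "h \<in> Arr C" "Dom C h = A" "p = dag h \<cdot> h"
    using assms(1) by (auto simp: pos_def)
  then show ?thesis
    unfolding pos_def using assms(2-) by (intro CollectI exI [of _ "h \<cdot> u"]) simp
qed

lemma pos_Tensor:
  assumes "p \<in> pos A" "X \<in> Obj C"
  shows "\<one> X \<otimes> p \<in> pos (X \<odot> A)"
proof -
  obtain h where "h \<in> Arr C" "Dom C h = A" "p = dag h \<cdot> h"
    using assms(1) by (auto simp: pos_def)
  then show ?thesis
    unfolding pos_def using assms(2-) by (intro CollectI exI [of _ "\<one> X \<otimes> h"]) simp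
qed

lemma dilation_simps [simp]:
  assumes "f \<in> Arr C" "Cod C f = X \<odot> B" "X \<in> Obj C" "B \<in> Obj C" "Y \<in> Obj C"
  shows "dilation X B f Y \<in> Arr C" "Dom C (dilation X B f Y) = Dom C f \<odot> Y"
    "Cod C (dilation X B f Y) = X \<odot> (B \<odot> Y)"
  using assms by (simp_all add: dilation_def)

lemma pull_pos [simp]:
  assumes "f \<in> Arr C" "Cod C f = X \<odot> B" "X \<in> Obj C" "B \<in> Obj C" "Y \<in> Obj C" "p \<in> pos (B \<odot> Y)"
    "Dom C f = A"
  shows "pull X B f Y p \<in> pos (A \<odot> Y)"
  unfolding pull_def using assms by (intro pos_conj [OF pos_Tensor]) simp_all

lemma probe_eq_pull:
  assumes "f \<in> Arr C" "Cod C f = X \<odot> B" "X \<in> Obj C" "B \<in> Obj C" "Y \<in> Obj C"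
    "h \<in> Arr C" "Dom C h = B \<odot> Y"
  shows "probe C dag B Y X f h = pull X B f Y (dag h \<cdot> h)"
  using assms by (simp add: probe_def pull_def dilation_def)

text \<open>The quantifier over \<open>Z\<close> is absorbed by \<open>pos\<close>, because the
  codomain of \<open>h\<close> is always an object.\<close>

lemma anc_equiv_iff_pull:
  assumes "f \<in> Arr C" "Cod C f = X \<odot> B" "X \<in> Obj C" "B \<in> Obj C"
    "f' \<in> Arr C" "Cod C f' = X' \<odot> B" "X' \<in> Obj C"
  shows "anc_equiv C dag B (X, f) (X', f')
    \<longleftrightarrow> (\<forall>Y \<in> Obj C. \<forall>p \<in> pos (B \<odot> Y). pull X B f Y p = pull X' B f' Y p)"
  unfolding anc_equiv_def pos_def using assms
  by (simp add: probe_eq_pull Ball_def) (metis Dom_Cod_Obj(2))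

text \<open>Naturality in the test system: \<open>v\<close> acts on the last factor only, where
  \<open>f\<close> is the identity, so naturality of the associator carries it through the
  dilation.\<close>

lemma pull_slide:
  assumes "f \<in> Arr C" "Cod C f = X \<odot> B" "X \<in> Obj C" "B \<in> Obj C" "v \<in> Arr C"
    "p \<in> pos (B \<odot> Cod C v)"
  shows "pull X B f (Dom C v) (dag (\<one> B \<otimes> v) \<cdot> p \<cdot> (\<one> B \<otimes> v))
    = dag (\<one> (Dom C f) \<otimes> v) \<cdot> pull X B f (Cod C v) p \<cdot> (\<one> (Dom C f) \<otimes> v)"
proof -
  note p = pos_Arr [OF assms(6)]
  have *: "(\<one> X \<otimes> (\<one> B \<otimes> v)) \<cdot> dilation X B f (Dom C v) = dilation X B f (Cod C v) \<cdot> (\<one> (Dom C f) \<otimes> v)"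
    using assms p Assoc_nat_Comp [OF _ _ _ refl refl refl, of "\<one> X" "\<one> B" v "f \<otimes> \<one> (Dom C v)"] by (simp add: dilation_def)
  have "pull X B f (Dom C v) (dag (\<one> B \<otimes> v) \<cdot> p \<cdot> (\<one> B \<otimes> v))
    = dag ((\<one> X \<otimes> (\<one> B \<otimes> v)) \<cdot> dilation X B f (Dom C v)) \<cdot> (\<one> X \<otimes> p)
        \<cdot> ((\<one> X \<otimes> (\<one> B \<otimes> v)) \<cdot> dilation X B f (Dom C v))"
    using assms p by (simp add: pull_def)
  then show ?thesis
    unfolding * using assms p by (simp add: pull_def)
qed

text \<open>\<open>u\<close> acts on the ancilla and \<open>p\<close> on the remaining factors, so
  the two commute, and \<open>u\<close> then cancels against its dagger.\<close>

lemma pull_eqI: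
  assumes "dilation X' B f' Y = (u \<otimes> \<one> (B \<odot> Y)) \<cdot> dilation X B f Y" "dag u \<cdot> u = \<one> X"
    "f \<in> Arr C" "Cod C f = X \<odot> B" "X \<in> Obj C" "B \<in> Obj C" "Y \<in> Obj C" "p \<in> pos (B \<odot> Y)"
    "u \<in> Arr C" "Cod C u = X'" "Dom C u = X"
  shows "pull X' B f' Y p = pull X B f Y p"
  using assms pos_Arr [OF assms(8)] by (auto simp: pull_def)

text \<open>The equivalence does not see an isometry on the ancilla. Representatives whose ancillas
  are merely reordered or rebracketed are identified in this way.\<close>

lemma pull_isometry:
  assumes "dag u \<cdot> u = \<one> X" "u \<in> Arr C" "Cod C u = X'" "Dom C u = X"
    "f \<in> Arr C" "Cod C f = X \<odot> B" "B \<in> Obj C" "Y \<in> Obj C" "p \<in> pos (B \<odot> Y)"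
  shows "pull X' B ((u \<otimes> \<one> B) \<cdot> f) Y p = pull X B f Y p"
proof (rule pull_eqI [where u = u])
  have "X \<in> Obj C" using assms by auto
  then show "dilation X' B ((u \<otimes> \<one> B) \<cdot> f) Y = (u \<otimes> \<one> (B \<odot> Y)) \<cdot> dilation X B f Y"
    using assms Assoc_nat_Comp [OF _ _ _ refl refl refl, of u "\<one> B" "\<one> Y" "f \<otimes> \<one> Y"] by (simp add: dilation_def)
qed (use assms in auto)

text \<open>The pentagon turns the dilation of a composite into two nested dilations, up to an
  associator that regroups the ancillas \<open>X\<close> and \<open>Y\<close>.\<close>

lemma dilation_comp:
  assumes "f \<in> Arr C" "Cod C f = X \<odot> B" "X \<in> Obj C" "B \<in> Obj C" "Y \<in> Obj C"
    "g \<in> Arr C" "Dom C g = B" "Cod C g = Y \<odot> D" "D \<in> Obj C" "Z \<in> Obj C"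
  shows "dilation (X \<odot> Y) D (dag (\<alpha> X Y D) \<cdot> (\<one> X \<otimes> g) \<cdot> f) Z
    = dag (\<alpha> X Y (D \<odot> Z)) \<cdot> (\<one> X \<otimes> dilation Y D g Z) \<cdot> dilation X B f Z"
proof -
  have "dilation (X \<odot> Y) D (dag (\<alpha> X Y D) \<cdot> (\<one> X \<otimes> g) \<cdot> f) Z
    = (\<alpha> (X \<odot> Y) D Z \<cdot> (dag (\<alpha> X Y D) \<otimes> \<one> Z)) \<cdot> ((\<one> X \<otimes> g) \<otimes> \<one> Z) \<cdot> (f \<otimes> \<one> Z)"
    using assms by (simp add: dilation_def)
  also have "\<dots> = dag (\<alpha> X Y (D \<odot> Z)) \<cdot> (\<one> X \<otimes> \<alpha> Y D Z) \<cdot> (\<alpha> X (Y \<odot> D) Z \<cdot> ((\<one> X \<otimes> g) \<otimes> \<one> Z) \<cdot> (f \<otimes> \<one> Z))"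
    unfolding pentagon_dag [OF assms(3,5,9,10)] using assms by simp
  also have "\<dots> = dag (\<alpha> X Y (D \<odot> Z)) \<cdot> (\<one> X \<otimes> dilation Y D g Z) \<cdot> dilation X B f Z"
    using assms by (subst Assoc_nat_Comp) (simp_all add: dilation_def)
  finally show ?thesis .
qed

text \<open>With the dilations nested, the pull through \<open>g\<close> forms inside the pull
  through \<open>f\<close>. This is why composites act in reverse order.\<close>

lemma pull_comp:
  assumes "f \<in> Arr C" "Cod C f = X \<odot> B" "X \<in> Obj C" "B \<in> Obj C" "Y \<in> Obj C"
    "g \<in> Arr C" "Dom C g = B" "Cod C g = Y \<odot> D" "D \<in> Obj C" "Z \<in> Obj C" "p \<in> pos (D \<odot> Z)"
  shows "pull (X \<odot> Y) D (dag (\<alpha> X Y D) \<cdot> (\<one> X \<otimes> g) \<cdot> f) Z p = pull X B f Z (pull Y D g Z p)"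
proof -
  note p = pos_Arr [OF assms(11)]
  \<comment> \<open>The regrouping associator and its dagger surround
    \<open>\<one> (X \<odot> Y) \<otimes> p\<close> and cancel by naturality.\<close>
  have "\<alpha> X Y (D \<odot> Z) \<cdot> (\<one> (X \<odot> Y) \<otimes> p) \<cdot> dag (\<alpha> X Y (D \<odot> Z)) = \<one> X \<otimes> (\<one> Y \<otimes> p)"
    using assms p Assoc_nat_Comp [OF _ _ _ refl refl refl, of "\<one> X" "\<one> Y" p "dag (\<alpha> X Y (D \<odot> Z))"] by simp
  from Comp_reassoc [OF this] have
    "\<alpha> X Y (D \<odot> Z) \<cdot> (\<one> (X \<odot> Y) \<otimes> p) \<cdot> dag (\<alpha> X Y (D \<odot> Z)) \<cdot> k = (\<one> X \<otimes> (\<one> Y \<otimes> p)) \<cdot> k"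
    if "k \<in> Arr C" "Cod C k = X \<odot> (Y \<odot> (D \<odot> Z))" for k
    using that assms p by simp
  then show ?thesis
    unfolding pull_def [of "X \<odot> Y"] dilation_comp [OF assms(1-10)]
    using assms p by (simp add: pull_def)
qed

text \<open>With ancilla \<open>\<I>\<close> the pull reduces to plain conjugation:
  \<open>LUnit_Tensor\<close> absorbs the associator of the dilation, and naturality of the unitor
  removes \<open>\<one> \<I>\<close>.\<close>

lemma pull_embed:
  assumes "u \<in> Arr C" "Cod C u = B" "Y \<in> Obj C" "p \<in> pos (B \<odot> Y)"
  shows "pull \<I> B (dag (\<l> B) \<cdot> u) Y p = dag (u \<otimes> \<one> Y) \<cdot> p \<cdot> (u \<otimes> \<one> Y)"
proof -
  note p = pos_Arr [OF assms(4)]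
  have B: "B \<in> Obj C" using assms p by auto
  have "\<alpha> \<I> B Y \<cdot> (dag (\<l> B) \<otimes> \<one> Y) = dag (\<l> (B \<odot> Y)) \<cdot> (\<l> (B \<odot> Y) \<cdot> \<alpha> \<I> B Y) \<cdot> (dag (\<l> B) \<otimes> \<one> Y)"
    using assms p B by simp
  also have "\<dots> = dag (\<l> (B \<odot> Y))"
    unfolding LUnit_Tensor [OF B assms(3)] using assms p B by simp
  finally have "\<alpha> \<I> B Y \<cdot> (dag (\<l> B) \<otimes> \<one> Y) = dag (\<l> (B \<odot> Y))" .
  from Comp_reassoc [OF this, of "u \<otimes> \<one> Y"]
  have *: "dilation \<I> B (dag (\<l> B) \<cdot> u) Y = dag (\<l> (B \<odot> Y)) \<cdot> (u \<otimes> \<one> Y)"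
    using assms p B by (simp add: dilation_def)
  have "\<l> (B \<odot> Y) \<cdot> (\<one> \<I> \<otimes> p) \<cdot> dag (\<l> (B \<odot> Y)) = p"
    using assms p B Comp_reassoc [OF LUnit_nat [of p "B \<odot> Y"], of "dag (\<l> (B \<odot> Y))"] by simp
  from Comp_reassoc [OF this, of "u \<otimes> \<one> Y"] show ?thesis
    unfolding pull_def * using assms p B by simp
qed

text \<open>The pentagon expresses the dilation of the whiskered arrow at \<open>Y\<close> by that
  of \<open>f\<close> at \<open>W \<odot> Y\<close>. Hence the class of the whiskered arrow depends
  only on the class of \<open>f\<close>.\<close>

lemma pull_whisker:
  assumes "f \<in> Arr C" "Cod C f = X \<odot> B" "Dom C f = A" "X \<in> Obj C" "B \<in> Obj C" "W \<in> Obj C" "Y \<in> Obj C"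
    "p \<in> pos ((B \<odot> W) \<odot> Y)"
  shows "pull X (B \<odot> W) (\<alpha> X B W \<cdot> (f \<otimes> \<one> W)) Y p
    = dag (\<alpha> A W Y) \<cdot> pull X B f (W \<odot> Y) (\<alpha> B W Y \<cdot> p \<cdot> dag (\<alpha> B W Y)) \<cdot> \<alpha> A W Y"
proof -
  note p = pos_Arr [OF assms(8)]
  have A: "A \<in> Obj C" using assms p by auto
  have "dilation X (B \<odot> W) (\<alpha> X B W \<cdot> (f \<otimes> \<one> W)) Y
    = (\<one> X \<otimes> dag (\<alpha> B W Y)) \<cdot> ((\<one> X \<otimes> \<alpha> B W Y) \<cdot> \<alpha> X (B \<odot> W) Y \<cdot> (\<alpha> X B W \<otimes> \<one> Y)) \<cdot> ((f \<otimes> \<one> W) \<otimes> \<one> Y)"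
    using assms p A by (simp add: dilation_def)
  also have "\<dots> = (\<one> X \<otimes> dag (\<alpha> B W Y)) \<cdot> \<alpha> X B (W \<odot> Y) \<cdot> (\<alpha> (X \<odot> B) W Y \<cdot> ((f \<otimes> \<one> W) \<otimes> \<one> Y))"
    unfolding pentagon [OF assms(4-7), symmetric] using assms p A by simp
  also have "\<dots> = (\<one> X \<otimes> dag (\<alpha> B W Y)) \<cdot> dilation X B f (W \<odot> Y) \<cdot> \<alpha> A W Y"
    using assms p A by (subst Assoc_nat) (simp_all add: dilation_def)
  finally have *: "dilation X (B \<odot> W) (\<alpha> X B W \<cdot> (f \<otimes> \<one> W)) Y = \<dots>" .
  show ?thesis
    unfolding pull_def * using assms p A by simp
qed

end

subsection \<open>Braiding of representatives\<close>

context dagger_braided_monoidal_category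
begin

lemma braid_simps [simp]:
  assumes "A \<in> Obj C" "B \<in> Obj C"
  shows "\<sigma> A B \<in> Arr C" "Dom C (\<sigma> A B) = A \<odot> B" "Cod C (\<sigma> A B) = B \<odot> A"
  using braid_hom [OF assms] by simp_all

lemma braid_cancel [simp]:
  assumes "A \<in> Obj C" "B \<in> Obj C"
  shows "dag (\<sigma> A B) \<cdot> \<sigma> A B = \<one> (A \<odot> B)" "\<sigma> A B \<cdot> dag (\<sigma> A B) = \<one> (B \<odot> A)"
    "\<lbrakk>h \<in> Arr C; Cod C h = A \<odot> B\<rbrakk> \<Longrightarrow> dag (\<sigma> A B) \<cdot> \<sigma> A B \<cdot> h = h"
    "\<lbrakk>h \<in> Arr C; Cod C h = B \<odot> A\<rbrakk> \<Longrightarrow> \<sigma> A B \<cdot> dag (\<sigma> A B) \<cdot> h = h"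
  using assms unitary_cancel [OF braid_unitary] by simp_all

lemma braid_nat:
  assumes "f \<in> Arr C" "g \<in> Arr C" "Cod C f = A'" "Cod C g = B'"
  shows "\<sigma> A' B' \<cdot> (f \<otimes> g) = (g \<otimes> f) \<cdot> \<sigma> (Dom C f) (Dom C g)"
  using braid_natural [of f "Dom C f" A' g "Dom C g" B'] assms by simp

lemma hexagon1_dag:
  assumes "A \<in> Obj C" "B \<in> Obj C" "D \<in> Obj C"
  shows "\<alpha> B D A \<cdot> \<sigma> A (B \<odot> D) = (\<one> B \<otimes> \<sigma> A D) \<cdot> \<alpha> B A D \<cdot> (\<sigma> A B \<otimes> \<one> D) \<cdot> dag (\<alpha> A B D)"
proof -
  have "\<alpha> B D A \<cdot> \<sigma> A (B \<odot> D) = (\<alpha> B D A \<cdot> \<sigma> A (B \<odot> D) \<cdot> \<alpha> A B D) \<cdot> dag (\<alpha> A B D)"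
    using assms by simp
  then show ?thesis
    unfolding hexagon1 [OF assms] using assms by simp
qed

lemma hexagon2_dag:
  assumes "A \<in> Obj C" "B \<in> Obj C" "D \<in> Obj C"
  shows "dag (\<alpha> D A B) \<cdot> \<sigma> (A \<odot> B) D
    = (\<sigma> A D \<otimes> \<one> B) \<cdot> dag (\<alpha> A D B) \<cdot> (\<one> A \<otimes> \<sigma> B D) \<cdot> \<alpha> A B D"
proof -
  have "dag (\<alpha> D A B) \<cdot> \<sigma> (A \<odot> B) D = (dag (\<alpha> D A B) \<cdot> \<sigma> (A \<odot> B) D \<cdot> dag (\<alpha> A B D)) \<cdot> \<alpha> A B D"
    using assms by simp
  also have "\<dots> = ((\<sigma> A D \<otimes> \<one> B) \<cdot> dag (\<alpha> A D B) \<cdot> (\<one> A \<otimes> \<sigma> B D)) \<cdot> \<alpha> A B D"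
    using hexagon2 [OF assms] assms by (simp add: inv_arr_Assoc)
  finally show ?thesis
    using assms by simp
qed

text \<open>The left side is a right whiskering conjugated by braidings. Naturality moves
  \<open>g\<close> through the braiding, and a hexagon leaves only the braiding of \<open>B\<close>
  with the ancilla \<open>W\<close>, as in \<open>middle_braid\<close>.\<close>

lemma whisker_left_rep:
  assumes "g \<in> Arr C" "Cod C g = W \<odot> D" "Dom C g = A" "W \<in> Obj C" "D \<in> Obj C" "B \<in> Obj C"
  shows "(\<one> W \<otimes> dag (\<sigma> B D)) \<cdot> \<alpha> W D B \<cdot> (g \<otimes> \<one> B) \<cdot> \<sigma> B A
    = \<alpha> W B D \<cdot> (\<sigma> B W \<otimes> \<one> D) \<cdot> dag (\<alpha> B W D) \<cdot> (\<one> B \<otimes> g)"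
proof -
  have A: "A \<in> Obj C" using assms by auto
  have "(\<one> W \<otimes> dag (\<sigma> B D)) \<cdot> \<alpha> W D B \<cdot> (g \<otimes> \<one> B) \<cdot> \<sigma> B A
      = (\<one> W \<otimes> dag (\<sigma> B D)) \<cdot> (\<alpha> W D B \<cdot> \<sigma> B (W \<odot> D)) \<cdot> (\<one> B \<otimes> g)"
    using assms A braid_nat [of "\<one> B" g B "W \<odot> D"] by simp
  also have "\<dots> = \<alpha> W B D \<cdot> (\<sigma> B W \<otimes> \<one> D) \<cdot> dag (\<alpha> B W D) \<cdot> (\<one> B \<otimes> g)"
    unfolding hexagon1_dag [OF assms(6,4,5)] using assms A by simp
  finally show ?thesis .
qed

abbreviation mid :: "'o \<Rightarrow> 'o \<Rightarrow> 'o \<Rightarrow> 'o \<Rightarrow> 'm" where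
  "mid \<equiv> middle_braid C dag \<sigma>"

lemma mid_simps [simp]:
  assumes "X \<in> Obj C" "B \<in> Obj C" "Y \<in> Obj C" "D \<in> Obj C"
  shows "mid X B Y D \<in> Arr C" "Dom C (mid X B Y D) = (X \<odot> B) \<odot> (Y \<odot> D)"
    "Cod C (mid X B Y D) = (X \<odot> Y) \<odot> (B \<odot> D)"
  using assms by (simp_all add: middle_braid_def)

text \<open>The left side is the representative that composition assigns to whiskering
  \<open>f\<close> by \<open>A\<close> on the right and then \<open>g\<close> by \<open>B\<close> on
  the left. It equals the tensor representative already before passing to classes.\<close>

lemma tensor_rep:
  assumes "f \<in> Arr C" "Cod C f = X \<odot> B" "X \<in> Obj C" "B \<in> Obj C"
    and "g \<in> Arr C" "Cod C g = W \<odot> D" "Dom C g = A" "W \<in> Obj C" "D \<in> Obj C"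
  shows "dag (\<alpha> X W (B \<odot> D)) \<cdot> (\<one> X \<otimes> (\<alpha> W B D \<cdot> (\<sigma> B W \<otimes> \<one> D) \<cdot> dag (\<alpha> B W D) \<cdot> (\<one> B \<otimes> g)))
      \<cdot> \<alpha> X B A \<cdot> (f \<otimes> \<one> A) = mid X B W D \<cdot> (f \<otimes> g)"
proof -
  have A: "A \<in> Obj C" using assms by auto
  have "mid X B W D \<cdot> (f \<otimes> g) = dag (\<alpha> X W (B \<odot> D)) \<cdot>
      (\<one> X \<otimes> (\<alpha> W B D \<cdot> (\<sigma> B W \<otimes> \<one> D) \<cdot> dag (\<alpha> B W D))) \<cdot>
      \<alpha> X B (W \<odot> D) \<cdot> ((\<one> X \<otimes> \<one> B) \<otimes> g) \<cdot> (f \<otimes> \<one> A)"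
    using assms A by (simp add: middle_braid_def)
  also have "\<dots> = dag (\<alpha> X W (B \<odot> D)) \<cdot>
      (\<one> X \<otimes> (\<alpha> W B D \<cdot> (\<sigma> B W \<otimes> \<one> D) \<cdot> dag (\<alpha> B W D))) \<cdot>
      (\<one> X \<otimes> (\<one> B \<otimes> g)) \<cdot> \<alpha> X B A \<cdot> (f \<otimes> \<one> A)"
    using assms A by (subst Assoc_nat_Comp) simp_all
  also have "\<dots> = dag (\<alpha> X W (B \<odot> D)) \<cdot>
      (\<one> X \<otimes> (\<alpha> W B D \<cdot> (\<sigma> B W \<otimes> \<one> D) \<cdot> dag (\<alpha> B W D) \<cdot> (\<one> B \<otimes> g))) \<cdot> \<alpha> X B A \<cdot> (f \<otimes> \<one> A)"
    using assms A by simp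
  finally show ?thesis ..
qed

text \<open>The second hexagon splits the braiding of \<open>X \<odot> B\<close> with
  \<open>W\<close>: the crossing of \<open>B\<close> with \<open>W\<close> forms the middle braid,
  that of \<open>X\<close> with \<open>W\<close> ends up on the ancilla. The pentagons take care of
  the brackets.\<close>

lemma mid_swap:
  assumes "X \<in> Obj C" "B \<in> Obj C" "W \<in> Obj C" "D \<in> Obj C"
  shows "\<alpha> (W \<odot> X) B D \<cdot> ((dag (\<alpha> W X B) \<cdot> \<sigma> (X \<odot> B) W) \<otimes> \<one> D) \<cdot> dag (\<alpha> (X \<odot> B) W D)
    = (\<sigma> X W \<otimes> \<one> (B \<odot> D)) \<cdot> mid X B W D"
proof -
  have "\<alpha> (W \<odot> X) B D \<cdot> ((dag (\<alpha> W X B) \<cdot> \<sigma> (X \<odot> B) W) \<otimes> \<one> D) \<cdot> dag (\<alpha> (X \<odot> B) W D)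
      = \<alpha> (W \<odot> X) B D \<cdot> ((\<sigma> X W \<otimes> \<one> B) \<otimes> \<one> D) \<cdot> (dag (\<alpha> X W B) \<otimes> \<one> D) \<cdot> ((\<one> X \<otimes> \<sigma> B W) \<otimes> \<one> D)
          \<cdot> (\<alpha> X B W \<otimes> \<one> D) \<cdot> dag (\<alpha> (X \<odot> B) W D)"
    unfolding hexagon2_dag [OF assms(1-3)] using assms by simp
  also have "\<dots> = (\<sigma> X W \<otimes> \<one> (B \<odot> D)) \<cdot> (\<alpha> (X \<odot> W) B D \<cdot> (dag (\<alpha> X W B) \<otimes> \<one> D)) \<cdot> ((\<one> X \<otimes> \<sigma> B W) \<otimes> \<one> D)
          \<cdot> ((\<alpha> X B W \<otimes> \<one> D) \<cdot> dag (\<alpha> (X \<odot> B) W D))"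
    using assms by (subst Assoc_nat_Comp) simp_all
  also have "\<dots> = (\<sigma> X W \<otimes> \<one> (B \<odot> D)) \<cdot> dag (\<alpha> X W (B \<odot> D)) \<cdot> (\<one> X \<otimes> \<alpha> W B D) \<cdot>
      (\<alpha> X (W \<odot> B) D \<cdot> ((\<one> X \<otimes> \<sigma> B W) \<otimes> \<one> D) \<cdot> dag (\<alpha> X (B \<odot> W) D)) \<cdot> (\<one> X \<otimes> dag (\<alpha> B W D)) \<cdot> \<alpha> X B (W \<odot> D)"
    unfolding pentagon_dag [OF assms(1,3,2,4)] pentagon_dag' [OF assms(1-4)] using assms by simp
  also have "\<dots> = (\<sigma> X W \<otimes> \<one> (B \<odot> D)) \<cdot> mid X B W D"
    using assms by (subst Assoc_nat_Comp) (simp_all add: middle_braid_def)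
  finally show ?thesis .
qed

text \<open>The counterpart of \<open>tensor_rep\<close> for the other order of whiskering. Here
  \<open>W\<close> is braided with \<open>A\<close> before \<open>f\<close> acts; naturality pushes
  \<open>f\<close> ahead, so that \<open>W\<close> crosses all of \<open>X \<odot> B\<close> and
  \<open>mid_swap\<close> applies.\<close>

lemma tensor_swap_rep:
  assumes "f \<in> Arr C" "Cod C f = X \<odot> B" "X \<in> Obj C" "B \<in> Obj C" "Dom C f = A"
    and "g \<in> Arr C" "Cod C g = W \<odot> D" "W \<in> Obj C" "D \<in> Obj C"
  shows "dag (\<alpha> W X (B \<odot> D)) \<cdot> (\<one> W \<otimes> (\<alpha> X B D \<cdot> (f \<otimes> \<one> D)))
      \<cdot> \<alpha> W A D \<cdot> (\<sigma> A W \<otimes> \<one> D) \<cdot> dag (\<alpha> A W D) \<cdot> (\<one> A \<otimes> g)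
    = (\<sigma> X W \<otimes> \<one> (B \<odot> D)) \<cdot> mid X B W D \<cdot> (f \<otimes> g)" (is "?lhs = _")
proof -
  have A: "A \<in> Obj C" using assms by auto
  have nat: "\<alpha> W (X \<odot> B) D \<cdot> ((\<one> W \<otimes> f) \<otimes> \<one> D) = (\<one> W \<otimes> (f \<otimes> \<one> D)) \<cdot> \<alpha> W A D"
    using assms A Assoc_nat [of "\<one> W" f "\<one> D" W "X \<odot> B" D] by simp
  have nat': "dag (\<alpha> (X \<odot> B) W D) \<cdot> (f \<otimes> \<one> (W \<odot> D)) = ((f \<otimes> \<one> W) \<otimes> \<one> D) \<cdot> dag (\<alpha> A W D)"
  proof -
    have "((f \<otimes> \<one> W) \<otimes> \<one> D) \<cdot> dag (\<alpha> A W D)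
        = dag (\<alpha> (X \<odot> B) W D) \<cdot> \<alpha> (X \<odot> B) W D \<cdot> ((f \<otimes> \<one> W) \<otimes> \<one> D) \<cdot> dag (\<alpha> A W D)"
      using assms A by simp
    also have "\<dots> = dag (\<alpha> (X \<odot> B) W D) \<cdot> (f \<otimes> \<one> (W \<odot> D))"
      using assms A by (subst Assoc_nat_Comp) simp_all
    finally show ?thesis ..
  qed
  have "?lhs = dag (\<alpha> W X (B \<odot> D)) \<cdot> (\<one> W \<otimes> \<alpha> X B D) \<cdot> ((\<one> W \<otimes> (f \<otimes> \<one> D)) \<cdot> \<alpha> W A D)
      \<cdot> (\<sigma> A W \<otimes> \<one> D) \<cdot> dag (\<alpha> A W D) \<cdot> (\<one> A \<otimes> g)"
    using assms A by simp
  also have "\<dots> = (dag (\<alpha> W X (B \<odot> D)) \<cdot> (\<one> W \<otimes> \<alpha> X B D) \<cdot> \<alpha> W (X \<odot> B) D)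
      \<cdot> (((\<one> W \<otimes> f) \<cdot> \<sigma> A W) \<otimes> \<one> D) \<cdot> dag (\<alpha> A W D) \<cdot> (\<one> A \<otimes> g)"
    unfolding nat [symmetric] using assms A by simp
  also have "(\<one> W \<otimes> f) \<cdot> \<sigma> A W = \<sigma> (X \<odot> B) W \<cdot> (f \<otimes> \<one> W)"
    using assms A braid_nat [of f "\<one> W" "X \<odot> B" W] by simp
  also have "dag (\<alpha> W X (B \<odot> D)) \<cdot> (\<one> W \<otimes> \<alpha> X B D) \<cdot> \<alpha> W (X \<odot> B) D
      = \<alpha> (W \<odot> X) B D \<cdot> (dag (\<alpha> W X B) \<otimes> \<one> D)"
    using pentagon_dag [of W X B D] assms by simp
  also have "(\<alpha> (W \<odot> X) B D \<cdot> (dag (\<alpha> W X B) \<otimes> \<one> D)) \<cdot> ((\<sigma> (X \<odot> B) W \<cdot> (f \<otimes> \<one> W)) \<otimes> \<one> D)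
        \<cdot> dag (\<alpha> A W D) \<cdot> (\<one> A \<otimes> g)
      = \<alpha> (W \<odot> X) B D \<cdot> (dag (\<alpha> W X B) \<otimes> \<one> D) \<cdot> (\<sigma> (X \<odot> B) W \<otimes> \<one> D)
        \<cdot> (((f \<otimes> \<one> W) \<otimes> \<one> D) \<cdot> dag (\<alpha> A W D)) \<cdot> (\<one> A \<otimes> g)"
    using assms A by simp
  also have "\<dots> = (\<alpha> (W \<odot> X) B D \<cdot> ((dag (\<alpha> W X B) \<cdot> \<sigma> (X \<odot> B) W) \<otimes> \<one> D) \<cdot> dag (\<alpha> (X \<odot> B) W D)) \<cdot> (f \<otimes> g)"
    unfolding nat' [symmetric] using assms A by simp
  also have "\<dots> = (\<sigma> X W \<otimes> \<one> (B \<odot> D)) \<cdot> mid X B W D \<cdot> (f \<otimes> g)"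
    unfolding mid_swap [OF assms(3,4,8,9)] using assms A by simp
  finally show ?thesis .
qed

text \<open>The triangle and \<open>LUnit_Tensor\<close> collect all coherence maps into
  \<open>\<r> W \<cdot> \<sigma> \<I> W \<cdot> dag (\<l> W)\<close>, a unitary on the ancilla,
  which disappears in the class.\<close>

lemma LUnit_whisker_rep:
  assumes "g \<in> Arr C" "Cod C g = W \<odot> D" "Dom C g = A" "W \<in> Obj C" "D \<in> Obj C"
  shows "(\<one> W \<otimes> \<l> D) \<cdot> \<alpha> W \<I> D \<cdot> (\<sigma> \<I> W \<otimes> \<one> D) \<cdot> dag (\<alpha> \<I> W D) \<cdot> (\<one> \<I> \<otimes> g)
    = ((\<r> W \<cdot> \<sigma> \<I> W \<cdot> dag (\<l> W)) \<otimes> \<one> D) \<cdot> g \<cdot> \<l> A"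
proof -
  have A: "A \<in> Obj C" using assms by auto
  have "dag (\<alpha> \<I> W D) = (dag (\<l> W) \<otimes> \<one> D) \<cdot> (\<l> W \<otimes> \<one> D) \<cdot> dag (\<alpha> \<I> W D)"
    using assms by simp
  also have "\<dots> = (dag (\<l> W) \<otimes> \<one> D) \<cdot> \<l> (W \<odot> D)"
    unfolding LUnit_Tensor [OF assms(4,5), symmetric] using assms by simp
  finally have *: "dag (\<alpha> \<I> W D) = (dag (\<l> W) \<otimes> \<one> D) \<cdot> \<l> (W \<odot> D)" .
  have "(\<one> W \<otimes> \<l> D) \<cdot> \<alpha> W \<I> D \<cdot> (\<sigma> \<I> W \<otimes> \<one> D) \<cdot> dag (\<alpha> \<I> W D) \<cdot> (\<one> \<I> \<otimes> g)
      = ((\<one> W \<otimes> \<l> D) \<cdot> \<alpha> W \<I> D) \<cdot> (\<sigma> \<I> W \<otimes> \<one> D) \<cdot> (dag (\<l> W) \<otimes> \<one> D) \<cdot> (\<l> (W \<odot> D) \<cdot> (\<one> \<I> \<otimes> g))"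
    unfolding * using assms A by simp
  then show ?thesis
    unfolding triangle [OF assms(4,5)] using assms A LUnit_nat [of g "W \<odot> D"] by simp
qed

end

subsection \<open>The category of completely positive maps\<close>

context dagger_monoidal_category
begin

text \<open>Kept folded so that nested conjugations merge by \<open>conjby_conjby\<close> into one
  conjugation by a composite, and membership in \<open>pos\<close> is decided without
  expanding.\<close>

definition conjby :: "'m \<Rightarrow> 'm \<Rightarrow> 'm" where
  "conjby u p = dag u \<cdot> p \<cdot> u"

lemma conjby_pos [simp]:
  assumes "p \<in> pos (Cod C u)" "u \<in> Arr C" "Dom C u = A"
  shows "conjby u p \<in> pos A"
  unfolding conjby_def using pos_conj [OF assms(1,2) refl assms(3)] .

lemma conjby_conjby [simp]:
  assumes "p \<in> pos (Cod C v)" "u \<in> Arr C" "v \<in> Arr C" "Cod C u = Dom C v"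
  shows "conjby u (conjby v p) = conjby (v \<cdot> u) p"
  using assms(2-) pos_Arr [OF assms(1)] by (simp add: conjby_def)

lemma conjby_Ident [simp]: "p \<in> pos A \<Longrightarrow> A \<in> Obj C \<Longrightarrow> conjby (\<one> A) p = p"
  using pos_Arr [of p A] by (simp add: conjby_def)

end

context dagger_braided_monoidal_category
begin

abbreviation CP :: "('o, ('o, 'm) cp_arr) monoidal_structure" where
  "CP \<equiv> CP_inf C dag \<sigma>"

abbreviation cls :: "'o \<Rightarrow> 'o \<Rightarrow> 'o \<Rightarrow> 'm \<Rightarrow> ('o, 'm) cp_arr" where
  "cls \<equiv> cp_class C dag"

abbreviation emb :: "'m \<Rightarrow> ('o, 'm) cp_arr" where
  "emb \<equiv> cp_embed C dag"

definition rep :: "'o \<Rightarrow> 'o \<Rightarrow> 'o \<Rightarrow> 'm \<Rightarrow> bool" where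
  "rep A B X f \<longleftrightarrow> A \<in> Obj C \<and> B \<in> Obj C \<and> X \<in> Obj C \<and> f \<in> Arr C \<and> Dom C f = A \<and> Cod C f = X \<odot> B"

lemma CP_objects [simp]:
  "Obj CP = Obj C" "\<I>\<^bsub>CP\<^esub> = \<I>" "A \<odot>\<^bsub>CP\<^esub> B = A \<odot> B"
  by (simp_all add: CP_inf_def)

lemma cp_rel_iff:
  assumes "B \<in> Obj C" "A \<in> Obj C"
  shows "((X, f), (X', f')) \<in> cp_rel C dag A B \<longleftrightarrow> rep A B X f \<and> rep A B X' f' \<and>
    (\<forall>Y \<in> Obj C. \<forall>p \<in> pos (B \<odot> Y). pull X B f Y p = pull X' B f' Y p)"
  using assms by (auto simp: cp_rel_def cp_reps_def rep_def anc_equiv_iff_pull)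

lemma equiv_cp_rel:
  assumes "A \<in> Obj C" "B \<in> Obj C"
  shows "equiv (cp_reps C A B) (cp_rel C dag A B)"
proof (intro equivI)
  show "refl_on (cp_reps C A B) (cp_rel C dag A B)"
    using assms by (auto simp: refl_on_def cp_rel_iff) (auto simp: cp_reps_def rep_def)
  show "cp_rel C dag A B \<subseteq> cp_reps C A B \<times> cp_reps C A B"
    by (auto simp: cp_rel_def)
  show "sym (cp_rel C dag A B)"
    using assms by (auto simp: sym_def cp_rel_iff)
  show "trans (cp_rel C dag A B)"
    using assms by (auto simp: trans_def cp_rel_iff)
qed

lemma cls_eq_iff:
  assumes "rep A B X f" "rep A B X' f'"
  shows "cls A B X f = cls A B X' f'
    \<longleftrightarrow> (\<forall>Y \<in> Obj C. \<forall>p \<in> pos (B \<odot> Y). pull X B f Y p = pull X' B f' Y p)"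
proof -
  have "A \<in> Obj C" "B \<in> Obj C" and r: "(X, f) \<in> cp_reps C A B" "(X', f') \<in> cp_reps C A B"
    using assms by (auto simp: rep_def cp_reps_def)
  then show ?thesis
    using eq_equiv_class_iff [OF equiv_cp_rel r] assms by (auto simp: cp_class_def cp_rel_iff)
qed

lemma cls_Arr [simp]:
  assumes "rep A B X f"
  shows "cls A B X f \<in> Arr CP" "Dom CP (cls A B X f) = A" "Cod CP (cls A B X f) = B"
  using assms by (auto simp: CP_inf_def cp_class_def rep_def cp_reps_def intro!: quotientI)

lemma Arr_CP_cases:
  assumes "k \<in> Arr CP"
  obtains X f where "rep (Dom CP k) (Cod CP k) X f" "k = cls (Dom CP k) (Cod CP k) X f"
  using assms by (auto simp: CP_inf_def cp_class_def rep_def cp_reps_def elim!: quotientE)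

text \<open>An arbitrary choice of representative. Functions defined through it are shown
  independent of the choice in \<open>eff_cls\<close> and \<open>whisker_cls\<close>.\<close>

definition rep_of :: "('o, 'm) cp_arr \<Rightarrow> 'o \<times> 'm" where
  "rep_of k = (SOME r. case r of (X, f) \<Rightarrow>
     rep (Dom CP k) (Cod CP k) X f \<and> k = cls (Dom CP k) (Cod CP k) X f)"

lemma rep_of_cls:
  assumes "rep A B X f"
  obtains X' f' where "rep_of (cls A B X f) = (X', f')" "rep A B X' f'" "cls A B X f = cls A B X' f'"
proof -
  have "\<exists>r. case r of (X', f') \<Rightarrow> rep A B X' f' \<and> cls A B X f = cls A B X' f'"
    using assms by auto
  from someI_ex [OF this] show ?thesis
    using assms that by (auto simp: rep_of_def split: prod.splits)
qed

text \<open>The family of maps from the introduction, now attached to the class instead of to a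
  representative.\<close>

definition eff :: "('o, 'm) cp_arr \<Rightarrow> 'o \<Rightarrow> 'm \<Rightarrow> 'm" where
  "eff k Y p = (case rep_of k of (X, f) \<Rightarrow> pull X (Cod CP k) f Y p)"

lemma eff_cls [simp]:
  assumes "rep A B X f" "Y \<in> Obj C" "p \<in> pos (B \<odot> Y)"
  shows "eff (cls A B X f) Y p = pull X B f Y p"
proof -
  obtain X' f' where "rep_of (cls A B X f) = (X', f')" "rep A B X' f'" "cls A B X f = cls A B X' f'"
    using rep_of_cls [OF assms(1)] .
  moreover from this have "pull X' B f' Y p = pull X B f Y p"
    using assms cls_eq_iff by metis
  ultimately show ?thesis
    using assms(1) by (simp add: eff_def)
qed

lemma eff_pos [simp]:
  assumes "k \<in> Arr CP" "Y \<in> Obj C" "p \<in> pos (Cod CP k \<odot> Y)" "Dom CP k = A"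
  shows "eff k Y p \<in> pos (A \<odot> Y)"
proof -
  obtain X f where "rep (Dom CP k) (Cod CP k) X f" "k = cls (Dom CP k) (Cod CP k) X f"
    using assms(1) by (rule Arr_CP_cases)
  then show ?thesis
    using eff_cls [of "Dom CP k" "Cod CP k" X f Y p] assms by (simp add: rep_def)
qed

lemma eff_slide:
  assumes "k \<in> Arr CP" "v \<in> Arr C" "p \<in> pos (Cod CP k \<odot> Cod C v)" "Dom C v = Y" "Cod CP k = B"
  shows "eff k Y (conjby (\<one> B \<otimes> v) p) = conjby (\<one> (Dom CP k) \<otimes> v) (eff k (Cod C v) p)"
proof -
  obtain X f where r: "rep (Dom CP k) (Cod CP k) X f" and k: "k = cls (Dom CP k) (Cod CP k) X f"
    using assms(1) by (rule Arr_CP_cases)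
  have B: "B \<in> Obj C" using r assms by (simp add: rep_def)
  have "eff k Y (conjby (\<one> B \<otimes> v) p) = pull X B f Y (conjby (\<one> B \<otimes> v) p)"
    using r assms B by (subst k) auto
  also have "\<dots> = conjby (\<one> (Dom CP k) \<otimes> v) (pull X B f (Cod C v) p)"
    unfolding conjby_def using pull_slide [of f X B v p] r assms by (simp add: rep_def)
  also have "pull X B f (Cod C v) p = eff k (Cod C v) p"
    using r assms by (subst k) auto
  finally show ?thesis .
qed

text \<open>Extensionality: the equivalence is exactly equality of the actions, so an equation
  between classes can be checked through \<open>eff\<close> without choosing
  representatives.\<close>

lemma CP_eqI:
  assumes "a \<in> Arr CP" "b \<in> Arr CP" "Dom CP a = Dom CP b" "Cod CP a = Cod CP b"
    and "\<And>Y p. \<lbrakk>Y \<in> Obj C; p \<in> pos (Cod CP b \<odot> Y)\<rbrakk> \<Longrightarrow> eff a Y p = eff b Y p"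
  shows "a = b"
proof -
  obtain X f where "rep (Dom CP a) (Cod CP a) X f" "a = cls (Dom CP a) (Cod CP a) X f"
    using assms(1) by (rule Arr_CP_cases)
  note a = this [unfolded assms(3,4)]
  obtain X' f' where b: "rep (Dom CP b) (Cod CP b) X' f'" "b = cls (Dom CP b) (Cod CP b) X' f'"
    using assms(2) by (rule Arr_CP_cases)
  have "pull X (Cod CP b) f Y p = pull X' (Cod CP b) f' Y p" if "Y \<in> Obj C" "p \<in> pos (Cod CP b \<odot> Y)" for Y p
    using assms(5) [OF that] eff_cls [OF a(1) that] eff_cls [OF b(1) that]
    unfolding a(2) [symmetric] b(2) [symmetric] by simp
  then show ?thesis
    by (subst a(2), subst b(2), subst cls_eq_iff [OF a(1) b(1)]) blast
qed

text \<open>Composition and tensor are unions over all pairs of representatives. If every pair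
  yields the same class \<open>k\<close>, the union is of a constant family and collapses to
  \<open>k\<close>.\<close>

lemma UN_rel_eq_cls:
  assumes "rep A B X f" "rep A' B' X' f'"
    and "\<And>Z g Z' g'. \<lbrakk>rep A B Z g; rep A' B' Z' g'; cls A B Z g = cls A B X f; cls A' B' Z' g' = cls A' B' X' f'\<rbrakk>
      \<Longrightarrow> cls E D (\<phi> Z Z') (\<psi> Z g Z' g') = k"
  shows "(E, D, \<Union>(Z, g) \<in> cp_rel C dag A B `` {(X, f)}. \<Union>(Z', g') \<in> cp_rel C dag A' B' `` {(X', f')}.
    cp_rel C dag E D `` {(\<phi> Z Z', \<psi> Z g Z' g')}) = k"
proof -
  have rel: "(Z, g) \<in> cp_rel C dag A B `` {(X, f)} \<longleftrightarrow> rep A B Z g \<and> cls A B Z g = cls A B X f"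
    if "rep A B X f" for A B X f Z g
    using that cls_eq_iff [OF _ that] by (auto simp: cp_rel_iff rep_def)
  have k: "cp_rel C dag E D `` {(\<phi> Z Z', \<psi> Z g Z' g')} = snd (snd k)" "fst k = E" "fst (snd k) = D"
    if "(Z, g) \<in> cp_rel C dag A B `` {(X, f)}" "(Z', g') \<in> cp_rel C dag A' B' `` {(X', f')}" for Z g Z' g'
    using assms(3) [of Z g Z' g'] that unfolding rel [OF assms(1)] rel [OF assms(2)]
    by (auto simp: cp_class_def)
  \<comment> \<open>Nonempty index sets are what makes the union of a constant family equal to its
    value.\<close>
  have ne: "(X, f) \<in> cp_rel C dag A B `` {(X, f)}" "(X', f') \<in> cp_rel C dag A' B' `` {(X', f')}"
    unfolding rel [OF assms(1)] rel [OF assms(2)] using assms by simp_all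
  have "(\<Union>(Z, g) \<in> cp_rel C dag A B `` {(X, f)}. \<Union>(Z', g') \<in> cp_rel C dag A' B' `` {(X', f')}.
    cp_rel C dag E D `` {(\<phi> Z Z', \<psi> Z g Z' g')})
    = (\<Union>_ \<in> cp_rel C dag A B `` {(X, f)}. \<Union>_ \<in> cp_rel C dag A' B' `` {(X', f')}. snd (snd k))"
    unfolding case_prod_beta by (intro SUP_cong refl k(1)) simp_all
  also have "\<dots> = snd (snd k)"
    using ne by blast
  finally show ?thesis
    using k(2,3) [OF ne] by (simp add: prod_eq_iff)
qed

section \<open>Composition of classes\<close>

lemma rep_comp [simp]:
  assumes "rep A B X f" "rep B D Y g"
  shows "rep A D (X \<odot> Y) (dag (\<alpha> X Y D) \<cdot> (\<one> X \<otimes> g) \<cdot> f)"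
  using assms by (simp add: rep_def)

lemma cls_comp [simp]:
  assumes "rep A B X f" "rep B D Y g"
  shows "cls B D Y g \<cdot>\<^bsub>CP\<^esub> cls A B X f = cls A D (X \<odot> Y) (dag (\<alpha> X Y D) \<cdot> (\<one> X \<otimes> g) \<cdot> f)"
proof -
  have "cls A D (Z \<odot> Z') (dag (\<alpha> Z Z' D) \<cdot> (\<one> Z \<otimes> h') \<cdot> h)
      = cls A D (X \<odot> Y) (dag (\<alpha> X Y D) \<cdot> (\<one> X \<otimes> g) \<cdot> f)"
    if r: "rep A B Z h" "rep B D Z' h'" and e: "cls A B Z h = cls A B X f" "cls B D Z' h' = cls B D Y g"
    for Z h Z' h'
  proof -
    have "pull (Z \<odot> Z') D (dag (\<alpha> Z Z' D) \<cdot> (\<one> Z \<otimes> h') \<cdot> h) V p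
        = pull (X \<odot> Y) D (dag (\<alpha> X Y D) \<cdot> (\<one> X \<otimes> g) \<cdot> f) V p"
      if "V \<in> Obj C" "p \<in> pos (D \<odot> V)" for V p
    proof -
      \<comment> \<open>The representative applied second is replaced first. Agreement of
        \<open>h\<close> with \<open>f\<close> is known only on positive arguments, and
        \<open>pull Y D g V p\<close> is one.\<close>
      have "pull Z' D h' V p = pull Y D g V p"
        using e(2) cls_eq_iff r(2) assms(2) that by metis
      moreover have "pull Y D g V p \<in> pos (B \<odot> V)"
        using assms that by (simp add: rep_def)
      then have "pull Z B h V (pull Y D g V p) = pull X B f V (pull Y D g V p)"
        using e(1) cls_eq_iff r(1) assms(1) that by metis
      ultimately show ?thesis
        using r assms that by (simp add: pull_comp [where B = B] rep_def)
    qed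
    then show ?thesis
      using r assms by (subst cls_eq_iff) auto
  qed
  note * = UN_rel_eq_cls [OF assms, where \<phi> = "\<lambda>X Y. X \<odot> Y" and
      \<psi> = "\<lambda>X f Y g. dag (\<alpha> X Y D) \<cdot> (\<one> X \<otimes> g) \<cdot> f", OF this]
  then show ?thesis
    by (simp add: CP_inf_def cp_comp_def cp_class_def)
qed

lemma eff_comp:
  assumes "a \<in> Arr CP" "b \<in> Arr CP" "Dom CP b = Cod CP a" "Y \<in> Obj C" "p \<in> pos (Cod CP b \<odot> Y)"
  shows "eff (b \<cdot>\<^bsub>CP\<^esub> a) Y p = eff a Y (eff b Y p)"
proof -
  obtain X f where a: "rep (Dom CP a) (Cod CP a) X f" "a = cls (Dom CP a) (Cod CP a) X f"
    using assms(1) by (rule Arr_CP_cases)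
  obtain X' g where b: "rep (Cod CP a) (Cod CP b) X' g" "b = cls (Cod CP a) (Cod CP b) X' g"
    using Arr_CP_cases [OF assms(2)] assms(3) by metis
  have "pull X' (Cod CP b) g Y p \<in> pos (Cod CP a \<odot> Y)"
    using b assms by (simp add: rep_def)
  then have "eff (cls (Cod CP a) (Cod CP b) X' g \<cdot>\<^bsub>CP\<^esub> cls (Dom CP a) (Cod CP a) X f) Y p
      = eff (cls (Dom CP a) (Cod CP a) X f) Y (eff (cls (Cod CP a) (Cod CP b) X' g) Y p)"
    using a(1) b(1) assms(4,5) by (simp add: pull_comp [where B = "Cod CP a"] rep_def)
  then show ?thesis
    using a(2) b(2) by simp
qed

lemma comp_Arr:
  assumes "a \<in> Arr CP" "b \<in> Arr CP" "Dom CP b = Cod CP a"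
  shows "b \<cdot>\<^bsub>CP\<^esub> a \<in> Arr CP" "Dom CP (b \<cdot>\<^bsub>CP\<^esub> a) = Dom CP a" "Cod CP (b \<cdot>\<^bsub>CP\<^esub> a) = Cod CP b"
proof -
  obtain X f where a: "rep (Dom CP a) (Cod CP a) X f" "a = cls (Dom CP a) (Cod CP a) X f"
    using assms(1) by (rule Arr_CP_cases)
  obtain X' g where b: "rep (Cod CP a) (Cod CP b) X' g" "b = cls (Cod CP a) (Cod CP b) X' g"
    using Arr_CP_cases [OF assms(2)] assms(3) by metis
  have "cls (Cod CP a) (Cod CP b) X' g \<cdot>\<^bsub>CP\<^esub> cls (Dom CP a) (Cod CP a) X f \<in> Arr CP \<and>
    Dom CP (cls (Cod CP a) (Cod CP b) X' g \<cdot>\<^bsub>CP\<^esub> cls (Dom CP a) (Cod CP a) X f) = Dom CP a \<and>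
    Cod CP (cls (Cod CP a) (Cod CP b) X' g \<cdot>\<^bsub>CP\<^esub> cls (Dom CP a) (Cod CP a) X f) = Cod CP b"
    using a(1) b(1) by simp
  then show "b \<cdot>\<^bsub>CP\<^esub> a \<in> Arr CP" "Dom CP (b \<cdot>\<^bsub>CP\<^esub> a) = Dom CP a" "Cod CP (b \<cdot>\<^bsub>CP\<^esub> a) = Cod CP b"
    using a(2) b(2) by simp_all
qed

section \<open>Embedded arrows and the category laws\<close>

lemma rep_emb [simp]:
  assumes "u \<in> Arr C" "Dom C u = A" "Cod C u = B"
  shows "rep A B \<I> (dag (\<l> B) \<cdot> u)"
  using assms by (auto simp: rep_def)

lemma emb_Arr [simp]:
  assumes "u \<in> Arr C"
  shows "emb u \<in> Arr CP" "Dom CP (emb u) = Dom C u" "Cod CP (emb u) = Cod C u"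
  using assms by (simp_all add: cp_embed_def)

lemma eff_emb [simp]:
  assumes "u \<in> Arr C" "Y \<in> Obj C" "p \<in> pos (Cod C u \<odot> Y)"
  shows "eff (emb u) Y p = conjby (u \<otimes> \<one> Y) p"
  using assms by (simp add: cp_embed_def pull_embed conjby_def)

lemma CP_Ident: "A \<in> Obj C \<Longrightarrow> \<one>\<^bsub>CP\<^esub> A = emb (\<one> A)"
  by (simp add: CP_inf_def cp_embed_def)

lemma Arr_CP_Obj:
  assumes "k \<in> Arr CP"
  shows "Dom CP k \<in> Obj C" "Cod CP k \<in> Obj C"
  using Arr_CP_cases [OF assms] by (auto simp: rep_def)

sublocale CP: category CP
proof
  show "Dom CP f \<in> Obj CP" "Cod CP f \<in> Obj CP" if "f \<in> Arr CP" for f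
    using Arr_CP_Obj [OF that] by simp_all
  show "\<one>\<^bsub>CP\<^esub> A \<in> hom CP A A" if "A \<in> Obj CP" for A
    using that by (simp add: CP_Ident hom_def)
  show "g \<cdot>\<^bsub>CP\<^esub> f \<in> hom CP A D" if "f \<in> hom CP A B" "g \<in> hom CP B D" for f g A B D
    using that comp_Arr [of f g] by (simp add: hom_def)
  show "\<one>\<^bsub>CP\<^esub> B \<cdot>\<^bsub>CP\<^esub> f = f" if "f \<in> hom CP A B" for f A B
    using that Arr_CP_Obj [of f]
    by (intro CP_eqI) (auto simp: hom_def CP_Ident comp_Arr eff_comp)
  show "f \<cdot>\<^bsub>CP\<^esub> \<one>\<^bsub>CP\<^esub> A = f" if "f \<in> hom CP A B" for f A B
    using that Arr_CP_Obj [of f]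
    by (intro CP_eqI) (auto simp: hom_def CP_Ident comp_Arr eff_comp)
  show "(h \<cdot>\<^bsub>CP\<^esub> g) \<cdot>\<^bsub>CP\<^esub> f = h \<cdot>\<^bsub>CP\<^esub> (g \<cdot>\<^bsub>CP\<^esub> f)"
    if "f \<in> hom CP A B" "g \<in> hom CP B D" "h \<in> hom CP D E" for f g h A B D E
    using that by (intro CP_eqI) (auto simp: hom_def comp_Arr eff_comp)
qed

subsection \<open>Whiskering and the tensor product of classes\<close>

declare Arr_CP_Obj [simp]

lemma rep_post [simp]:
  assumes "rep A B X f" "u \<in> Arr C" "Dom C u = B" "Cod C u = D"
  shows "rep A D X ((\<one> X \<otimes> u) \<cdot> f)"
  using assms by (auto simp: rep_def)

lemma rep_pre [simp]:
  assumes "rep A B X f" "u \<in> Arr C" "Cod C u = A" "Dom C u = D"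
  shows "rep D B X (f \<cdot> u)"
  using assms by (auto simp: rep_def)

text \<open>The general formula for composition gives the ancilla \<open>X \<odot> \<I>\<close>. For
  an embedded second factor this finds a representative with ancilla \<open>X\<close>, because
  \<open>u\<close> acts beside the ancilla.\<close>

lemma emb_comp_cls:
  assumes "rep A B X f" "u \<in> Arr C" "Dom C u = B" "Cod C u = D"
  shows "emb u \<cdot>\<^bsub>CP\<^esub> cls A B X f = cls A D X ((\<one> X \<otimes> u) \<cdot> f)"
proof (rule CP_eqI)
  fix Y p assume *: "Y \<in> Obj C" "p \<in> pos (Cod CP (cls A D X ((\<one> X \<otimes> u) \<cdot> f)) \<odot> Y)"
  have f: "A \<in> Obj C" "B \<in> Obj C" "X \<in> Obj C" "f \<in> Arr C" "Dom C f = A" "Cod C f = X \<odot> B"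
    using assms(1) by (auto simp: rep_def)
  have D: "D \<in> Obj C" using assms by auto
  have p: "p \<in> pos (D \<odot> Y)" using * rep_post [OF assms] by simp
  have "dilation X D ((\<one> X \<otimes> u) \<cdot> f) Y = \<alpha> X D Y \<cdot> ((\<one> X \<otimes> u) \<otimes> \<one> Y) \<cdot> (f \<otimes> \<one> Y)"
    using assms(2-) f * by (simp add: dilation_def)
  also have "\<dots> = (\<one> X \<otimes> (u \<otimes> \<one> Y)) \<cdot> dilation X B f Y"
    using assms(2-) f D * by (subst Assoc_nat_Comp) (simp_all add: dilation_def)
  finally have "pull X D ((\<one> X \<otimes> u) \<cdot> f) Y p = pull X B f Y (conjby (u \<otimes> \<one> Y) p)"
    unfolding pull_def conjby_def using assms(2-) f D * pos_Arr [OF p] by simp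
  then show "eff (emb u \<cdot>\<^bsub>CP\<^esub> cls A B X f) Y p = eff (cls A D X ((\<one> X \<otimes> u) \<cdot> f)) Y p"
    using assms p * D rep_post [OF assms] f by (simp add: eff_comp)
qed (use assms rep_post [OF assms] in simp_all)

lemma cls_comp_emb:
  assumes "rep A B X f" "u \<in> Arr C" "Cod C u = A" "Dom C u = D"
  shows "cls A B X f \<cdot>\<^bsub>CP\<^esub> emb u = cls D B X (f \<cdot> u)"
proof (rule CP_eqI)
  fix Y p assume *: "Y \<in> Obj C" "p \<in> pos (Cod CP (cls D B X (f \<cdot> u)) \<odot> Y)"
  have f: "A \<in> Obj C" "B \<in> Obj C" "X \<in> Obj C" "f \<in> Arr C" "Dom C f = A" "Cod C f = X \<odot> B"
    using assms(1) by (auto simp: rep_def)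
  have p: "p \<in> pos (B \<odot> Y)" using * rep_pre [OF assms] by simp
  have "pull X B (f \<cdot> u) Y p = conjby (u \<otimes> \<one> Y) (pull X B f Y p)"
    unfolding pull_def conjby_def dilation_def using assms(2-) f * pos_Arr [OF p] by simp
  then show "eff (cls A B X f \<cdot>\<^bsub>CP\<^esub> emb u) Y p = eff (cls D B X (f \<cdot> u)) Y p"
    using assms p * rep_pre [OF assms] f by (simp add: eff_comp)
qed (use assms rep_pre [OF assms] in simp_all)

lemma emb_comp [simp]:
  assumes "u \<in> Arr C" "v \<in> Arr C" "Dom C v = Cod C u"
  shows "emb v \<cdot>\<^bsub>CP\<^esub> emb u = emb (v \<cdot> u)"
  by (rule CP_eqI) (use assms in \<open>simp_all add: eff_comp\<close>)

lemma emb_comp_comp [simp]: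
  assumes "u \<in> Arr C" "v \<in> Arr C" "Dom C v = Cod C u" "k \<in> Arr CP" "Cod CP k = Dom C u"
  shows "emb v \<cdot>\<^bsub>CP\<^esub> emb u \<cdot>\<^bsub>CP\<^esub> k = emb (v \<cdot> u) \<cdot>\<^bsub>CP\<^esub> k"
  by (rule CP.Comp_reassoc) (use assms in simp_all)

lemma emb_Ident_comp [simp]:
  assumes "k \<in> Arr CP"
  shows "Cod CP k = A \<Longrightarrow> emb (\<one> A) \<cdot>\<^bsub>CP\<^esub> k = k" "Dom CP k = A \<Longrightarrow> k \<cdot>\<^bsub>CP\<^esub> emb (\<one> A) = k"
  by (subst CP_Ident [symmetric]; use assms Arr_CP_Obj [OF assms] in auto)+

lemma cls_isometry:
  assumes "rep A B X f" "u \<in> Arr C" "Dom C u = X" "Cod C u = X'" "dag u \<cdot> u = \<one> X"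
  shows "rep A B X' ((u \<otimes> \<one> B) \<cdot> f)" "cls A B X' ((u \<otimes> \<one> B) \<cdot> f) = cls A B X f"
proof -
  show r: "rep A B X' ((u \<otimes> \<one> B) \<cdot> f)"
    using assms by (auto simp: rep_def)
  show "cls A B X' ((u \<otimes> \<one> B) \<cdot> f) = cls A B X f"
    using assms pull_isometry [OF assms(5,2,4,3)] by (subst cls_eq_iff [OF r]) (auto simp: rep_def)
qed

section \<open>Whiskering on the right\<close>

definition whisker :: "'o \<Rightarrow> ('o, 'm) cp_arr \<Rightarrow> ('o, 'm) cp_arr" where
  "whisker W k = (case rep_of k of (X, f) \<Rightarrow>
     cls (Dom CP k \<odot> W) (Cod CP k \<odot> W) X (\<alpha> X (Cod CP k) W \<cdot> (f \<otimes> \<one> W)))"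

lemma rep_whisker [simp]:
  assumes "rep A B X f" "W \<in> Obj C"
  shows "rep (A \<odot> W) (B \<odot> W) X (\<alpha> X B W \<cdot> (f \<otimes> \<one> W))"
  using assms by (simp add: rep_def)

lemma pull_whisker_conjby:
  assumes "rep A B X f" "W \<in> Obj C" "Y \<in> Obj C" "p \<in> pos ((B \<odot> W) \<odot> Y)"
  shows "pull X (B \<odot> W) (\<alpha> X B W \<cdot> (f \<otimes> \<one> W)) Y p
    = conjby (\<alpha> A W Y) (pull X B f (W \<odot> Y) (conjby (dag (\<alpha> B W Y)) p))"
  using pull_whisker [of f X B A W Y p] assms by (simp add: conjby_def rep_def)

lemma whisker_cls:
  assumes "rep A B X f" "W \<in> Obj C"
  shows "whisker W (cls A B X f) = cls (A \<odot> W) (B \<odot> W) X (\<alpha> X B W \<cdot> (f \<otimes> \<one> W))"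
proof -
  obtain X' f' where r: "rep_of (cls A B X f) = (X', f')" "rep A B X' f'" "cls A B X f = cls A B X' f'"
    using rep_of_cls [OF assms(1)] .
  have eq: "pull X' B f' Y p = pull X B f Y p" if "Y \<in> Obj C" "p \<in> pos (B \<odot> Y)" for Y p
    using r(3) that unfolding cls_eq_iff [OF assms(1) r(2)] by simp
  have "B \<in> Obj C" using assms(1) by (simp add: rep_def)
  then have "cls (A \<odot> W) (B \<odot> W) X' (\<alpha> X' B W \<cdot> (f' \<otimes> \<one> W))
      = cls (A \<odot> W) (B \<odot> W) X (\<alpha> X B W \<cdot> (f \<otimes> \<one> W))"
    unfolding cls_eq_iff [OF rep_whisker [OF r(2) assms(2)] rep_whisker [OF assms]]
    using assms r(2) eq by (simp add: pull_whisker_conjby)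
  then show ?thesis
    using assms r(1) by (simp add: whisker_def)
qed

lemma whisker_Arr [simp]:
  assumes "k \<in> Arr CP" "W \<in> Obj C"
  shows "whisker W k \<in> Arr CP" "Dom CP (whisker W k) = Dom CP k \<odot> W"
    "Cod CP (whisker W k) = Cod CP k \<odot> W"
proof -
  obtain X f where r: "rep (Dom CP k) (Cod CP k) X f" and k: "k = cls (Dom CP k) (Cod CP k) X f"
    using assms(1) by (rule Arr_CP_cases)
  note * = whisker_cls [OF r assms(2), folded k] and ** = cls_Arr [OF rep_whisker [OF r assms(2)]]
  show "whisker W k \<in> Arr CP" "Dom CP (whisker W k) = Dom CP k \<odot> W"
    "Cod CP (whisker W k) = Cod CP k \<odot> W"
    unfolding * using ** by simp_all
qed

lemma eff_whisker [simp]: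
  assumes "k \<in> Arr CP" "W \<in> Obj C" "Y \<in> Obj C" "p \<in> pos ((Cod CP k \<odot> W) \<odot> Y)"
  shows "eff (whisker W k) Y p
    = conjby (\<alpha> (Dom CP k) W Y) (eff k (W \<odot> Y) (conjby (dag (\<alpha> (Cod CP k) W Y)) p))"
proof -
  obtain X f where r: "rep (Dom CP k) (Cod CP k) X f" and k: "k = cls (Dom CP k) (Cod CP k) X f"
    using assms(1) by (rule Arr_CP_cases)
  have "eff (whisker W k) Y p = pull X (Cod CP k \<odot> W) (\<alpha> X (Cod CP k) W \<cdot> (f \<otimes> \<one> W)) Y p"
    using whisker_cls [OF r assms(2), folded k] rep_whisker [OF r assms(2)] assms by simp
  also have "\<dots> = conjby (\<alpha> (Dom CP k) W Y) (eff k (W \<odot> Y) (conjby (dag (\<alpha> (Cod CP k) W Y)) p))"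
    using eff_cls [OF r, folded k, of "W \<odot> Y" "conjby (dag (\<alpha> (Cod CP k) W Y)) p"] r assms
    by (simp add: pull_whisker_conjby rep_def)
  finally show ?thesis .
qed

lemma whisker_emb [simp]:
  assumes "u \<in> Arr C" "W \<in> Obj C"
  shows "whisker W (emb u) = emb (u \<otimes> \<one> W)"
proof (rule CP_eqI)
  fix Y p assume *: "Y \<in> Obj C" "p \<in> pos (Cod CP (emb (u \<otimes> \<one> W)) \<odot> Y)"
  have "dag (\<alpha> (Cod C u) W Y) \<cdot> (u \<otimes> \<one> (W \<odot> Y)) \<cdot> \<alpha> (Dom C u) W Y
      = dag (\<alpha> (Cod C u) W Y) \<cdot> \<alpha> (Cod C u) W Y \<cdot> ((u \<otimes> \<one> W) \<otimes> \<one> Y)"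
    using assms * by (subst Assoc_nat) simp_all
  then show "eff (whisker W (emb u)) Y p = eff (emb (u \<otimes> \<one> W)) Y p"
    using assms * by simp
qed (use assms in simp_all)

lemma whisker_comp [simp]:
  assumes "a \<in> Arr CP" "b \<in> Arr CP" "Dom CP b = Cod CP a" "W \<in> Obj C"
  shows "whisker W (b \<cdot>\<^bsub>CP\<^esub> a) = whisker W b \<cdot>\<^bsub>CP\<^esub> whisker W a"
proof (rule CP_eqI)
  fix Y p assume "Y \<in> Obj C" "p \<in> pos (Cod CP (whisker W b \<cdot>\<^bsub>CP\<^esub> whisker W a) \<odot> Y)"
  then show "eff (whisker W (b \<cdot>\<^bsub>CP\<^esub> a)) Y p = eff (whisker W b \<cdot>\<^bsub>CP\<^esub> whisker W a) Y p"
    using assms Arr_CP_Obj [of a] Arr_CP_Obj [of b] by (simp add: eff_comp)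
qed (use assms in simp_all)

text \<open>After rebracketing, \<open>u\<close> becomes \<open>u \<otimes> \<one> Y\<close> on the
  test system \<open>W \<odot> Y\<close>, and \<open>eff_slide\<close> moves it from the
  \<open>B\<close> side to the \<open>A\<close> side.\<close>

lemma whisker_slide:
  assumes "a \<in> Arr CP" "u \<in> Arr C" "Dom CP a = A" "Cod CP a = B" "Dom C u = W" "Cod C u = W'"
  shows "whisker W' a \<cdot>\<^bsub>CP\<^esub> emb (\<one> A \<otimes> u) = emb (\<one> B \<otimes> u) \<cdot>\<^bsub>CP\<^esub> whisker W a"
proof (rule CP_eqI)
  have obj: "A \<in> Obj C" "B \<in> Obj C" "W \<in> Obj C" "W' \<in> Obj C"
    using Arr_CP_Obj [of a] assms by auto
  fix Y p assume "Y \<in> Obj C" "p \<in> pos (Cod CP (emb (\<one> B \<otimes> u) \<cdot>\<^bsub>CP\<^esub> whisker W a) \<odot> Y)"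
  then have Y: "Y \<in> Obj C" and p: "p \<in> pos ((B \<odot> W') \<odot> Y)" using assms obj by simp_all
  have nat: "((\<one> B \<otimes> u) \<otimes> \<one> Y) \<cdot> dag (\<alpha> B W Y) = dag (\<alpha> B W' Y) \<cdot> (\<one> B \<otimes> (u \<otimes> \<one> Y))"
  proof -
    have "((\<one> B \<otimes> u) \<otimes> \<one> Y) \<cdot> dag (\<alpha> B W Y)
        = dag (\<alpha> B W' Y) \<cdot> \<alpha> B W' Y \<cdot> ((\<one> B \<otimes> u) \<otimes> \<one> Y) \<cdot> dag (\<alpha> B W Y)"
      using assms obj Y by simp
    also have "\<dots> = dag (\<alpha> B W' Y) \<cdot> (\<one> B \<otimes> (u \<otimes> \<one> Y))"
      using assms obj Y by (subst Assoc_nat_Comp) simp_all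
    finally show ?thesis .
  qed
  have "eff (emb (\<one> B \<otimes> u) \<cdot>\<^bsub>CP\<^esub> whisker W a) Y p
      = conjby (\<alpha> A W Y) (eff a (W \<odot> Y) (conjby (((\<one> B \<otimes> u) \<otimes> \<one> Y) \<cdot> dag (\<alpha> B W Y)) p))"
    using assms obj Y p by (simp add: eff_comp)
  also have "\<dots> = conjby (\<alpha> A W Y) (eff a (W \<odot> Y) (conjby (\<one> B \<otimes> (u \<otimes> \<one> Y)) (conjby (dag (\<alpha> B W' Y)) p)))"
    unfolding nat using assms obj Y p by simp
  also have "\<dots> = conjby (\<alpha> A W Y) (conjby (\<one> A \<otimes> (u \<otimes> \<one> Y)) (eff a (W' \<odot> Y) (conjby (dag (\<alpha> B W' Y)) p)))"
    using assms obj Y p by (subst eff_slide) simp_all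
  also have "\<dots> = eff (whisker W' a \<cdot>\<^bsub>CP\<^esub> emb (\<one> A \<otimes> u)) Y p"
    using assms obj Y p Assoc_nat [of "\<one> A" u "\<one> Y" A W' Y] by (simp add: eff_comp)
  finally show "eff (whisker W' a \<cdot>\<^bsub>CP\<^esub> emb (\<one> A \<otimes> u)) Y p
      = eff (emb (\<one> B \<otimes> u) \<cdot>\<^bsub>CP\<^esub> whisker W a) Y p" ..
qed (use assms Arr_CP_Obj [of a] in auto)

text \<open>Both sides evaluate \<open>a\<close> on \<open>W\<close>, \<open>V\<close> and
  \<open>Y\<close>, with different brackets. The pentagon on the \<open>B\<close> side leaves
  \<open>\<alpha> W V Y\<close> on the test system; it slides through \<open>a\<close> and completes
  the pentagon on the \<open>A\<close> side.\<close>

lemma whisker_whisker: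
  assumes "a \<in> Arr CP" "W \<in> Obj C" "V \<in> Obj C" "Dom CP a = A" "Cod CP a = B"
  shows "whisker V (whisker W a)
    = emb (dag (\<alpha> B W V)) \<cdot>\<^bsub>CP\<^esub> whisker (W \<odot> V) a \<cdot>\<^bsub>CP\<^esub> emb (\<alpha> A W V)"
proof (rule CP_eqI)
  have obj: "A \<in> Obj C" "B \<in> Obj C" using Arr_CP_Obj [of a] assms by auto
  fix Y p assume "Y \<in> Obj C"
    "p \<in> pos (Cod CP (emb (dag (\<alpha> B W V)) \<cdot>\<^bsub>CP\<^esub> whisker (W \<odot> V) a \<cdot>\<^bsub>CP\<^esub> emb (\<alpha> A W V)) \<odot> Y)"
  then have Y: "Y \<in> Obj C" and p: "p \<in> pos (((B \<odot> W) \<odot> V) \<odot> Y)" using assms obj by simp_all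
  let ?q = "conjby (dag (\<alpha> (B \<odot> W) V Y) \<cdot> dag (\<alpha> B W (V \<odot> Y))) p"
  have pent: "(dag (\<alpha> B W V) \<otimes> \<one> Y) \<cdot> dag (\<alpha> B (W \<odot> V) Y)
      = dag (\<alpha> (B \<odot> W) V Y) \<cdot> dag (\<alpha> B W (V \<odot> Y)) \<cdot> (\<one> B \<otimes> \<alpha> W V Y)"
  proof -
    have "(dag (\<alpha> B W V) \<otimes> \<one> Y) \<cdot> dag (\<alpha> B (W \<odot> V) Y)
        = ((dag (\<alpha> B W V) \<otimes> \<one> Y) \<cdot> dag (\<alpha> B (W \<odot> V) Y) \<cdot> (\<one> B \<otimes> dag (\<alpha> W V Y))) \<cdot> (\<one> B \<otimes> \<alpha> W V Y)"
      using assms obj Y by simp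
    also have "(dag (\<alpha> B W V) \<otimes> \<one> Y) \<cdot> dag (\<alpha> B (W \<odot> V) Y) \<cdot> (\<one> B \<otimes> dag (\<alpha> W V Y))
        = dag (\<alpha> (B \<odot> W) V Y) \<cdot> dag (\<alpha> B W (V \<odot> Y))"
      using arg_cong [OF pentagon [of B W V Y], of dag] assms obj Y by simp
    finally show ?thesis using assms obj Y by simp
  qed
  have "eff (emb (dag (\<alpha> B W V)) \<cdot>\<^bsub>CP\<^esub> whisker (W \<odot> V) a \<cdot>\<^bsub>CP\<^esub> emb (\<alpha> A W V)) Y p
      = conjby (\<alpha> A (W \<odot> V) Y \<cdot> (\<alpha> A W V \<otimes> \<one> Y)) (eff a ((W \<odot> V) \<odot> Y)
          (conjby ((dag (\<alpha> B W V) \<otimes> \<one> Y) \<cdot> dag (\<alpha> B (W \<odot> V) Y)) p))"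
    using assms obj Y p by (simp add: eff_comp)
  also have "\<dots> = conjby (\<alpha> A (W \<odot> V) Y \<cdot> (\<alpha> A W V \<otimes> \<one> Y)) (eff a ((W \<odot> V) \<odot> Y)
          (conjby (\<one> B \<otimes> \<alpha> W V Y) ?q))"
    unfolding pent using assms obj Y p by simp
  also have "\<dots> = conjby (\<alpha> A (W \<odot> V) Y \<cdot> (\<alpha> A W V \<otimes> \<one> Y)) (conjby (\<one> A \<otimes> \<alpha> W V Y)
          (eff a (W \<odot> (V \<odot> Y)) ?q))"
    using assms obj Y p by (subst eff_slide) simp_all
  also have "\<dots> = conjby (\<alpha> A W (V \<odot> Y) \<cdot> \<alpha> (A \<odot> W) V Y) (eff a (W \<odot> (V \<odot> Y)) ?q)"
    unfolding pentagon [OF obj(1) assms(2,3) Y] using assms obj Y p by simp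
  also have "\<dots> = eff (whisker V (whisker W a)) Y p"
    using assms obj Y p by simp
  finally show "eff (whisker V (whisker W a)) Y p
    = eff (emb (dag (\<alpha> B W V)) \<cdot>\<^bsub>CP\<^esub> whisker (W \<odot> V) a \<cdot>\<^bsub>CP\<^esub> emb (\<alpha> A W V)) Y p" ..
qed (use assms Arr_CP_Obj [of a] in auto)

text \<open>The triangle trades \<open>\<r> B\<close> for \<open>\<l> Y\<close> on the test system,
  which slides through \<open>a\<close> and is traded back on the \<open>A\<close> side.\<close>

lemma whisker_Unit:
  assumes "a \<in> Arr CP" "Dom CP a = A" "Cod CP a = B"
  shows "emb (\<r> B) \<cdot>\<^bsub>CP\<^esub> whisker \<I> a = a \<cdot>\<^bsub>CP\<^esub> emb (\<r> A)"
proof (rule CP_eqI)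
  have obj: "A \<in> Obj C" "B \<in> Obj C" using Arr_CP_Obj [of a] assms by auto
  fix Y p assume "Y \<in> Obj C" "p \<in> pos (Cod CP (a \<cdot>\<^bsub>CP\<^esub> emb (\<r> A)) \<odot> Y)"
  then have Y: "Y \<in> Obj C" and p: "p \<in> pos (B \<odot> Y)" using assms obj by simp_all
  have "eff (emb (\<r> B) \<cdot>\<^bsub>CP\<^esub> whisker \<I> a) Y p
      = conjby (\<alpha> A \<I> Y) (eff a (\<I> \<odot> Y) (conjby ((\<r> B \<otimes> \<one> Y) \<cdot> dag (\<alpha> B \<I> Y)) p))"
    using assms obj Y p by (simp add: eff_comp)
  also have "\<dots> = conjby (\<alpha> A \<I> Y) (eff a (\<I> \<odot> Y) (conjby (\<one> B \<otimes> \<l> Y) p))"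
    unfolding triangle [OF obj(2) Y, symmetric] using assms obj Y p by simp
  also have "\<dots> = conjby (\<alpha> A \<I> Y) (conjby (\<one> A \<otimes> \<l> Y) (eff a Y p))"
    using assms obj Y p by (subst eff_slide) simp_all
  also have "\<dots> = eff (a \<cdot>\<^bsub>CP\<^esub> emb (\<r> A)) Y p"
    using assms obj Y p by (simp add: eff_comp triangle)
  finally show "eff (emb (\<r> B) \<cdot>\<^bsub>CP\<^esub> whisker \<I> a) Y p = eff (a \<cdot>\<^bsub>CP\<^esub> emb (\<r> A)) Y p" .
qed (use assms Arr_CP_Obj [of a] in auto)

text \<open>The test system stands on the right of \<open>B\<close>, so only right whiskering has a
  direct expression through \<open>eff\<close>. Conjugation by the braiding transfers its properties
  to the left.\<close>

definition whisker_left :: "'o \<Rightarrow> ('o, 'm) cp_arr \<Rightarrow> ('o, 'm) cp_arr" where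
  "whisker_left W k = emb (dag (\<sigma> W (Cod CP k))) \<cdot>\<^bsub>CP\<^esub> whisker W k \<cdot>\<^bsub>CP\<^esub> emb (\<sigma> W (Dom CP k))"

lemma whisker_left_Arr [simp]:
  assumes "k \<in> Arr CP" "W \<in> Obj C"
  shows "whisker_left W k \<in> Arr CP" "Dom CP (whisker_left W k) = W \<odot> Dom CP k"
    "Cod CP (whisker_left W k) = W \<odot> Cod CP k"
  using assms Arr_CP_Obj [OF assms(1)] by (simp_all add: whisker_left_def)

lemma whisker_left_emb [simp]:
  assumes "u \<in> Arr C" "W \<in> Obj C"
  shows "whisker_left W (emb u) = emb (\<one> W \<otimes> u)"
  using assms braid_nat [of "\<one> W" u W "Cod C u", symmetric] by (simp add: whisker_left_def)

lemma whisker_left_comp [simp]: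
  assumes "a \<in> Arr CP" "b \<in> Arr CP" "Dom CP b = Cod CP a" "W \<in> Obj C"
  shows "whisker_left W (b \<cdot>\<^bsub>CP\<^esub> a) = whisker_left W b \<cdot>\<^bsub>CP\<^esub> whisker_left W a"
  using assms Arr_CP_Obj [OF assms(1)] Arr_CP_Obj [OF assms(2)] by (simp add: whisker_left_def)

lemma rep_whisker_left [simp]:
  assumes "rep A D X g" "B \<in> Obj C"
  shows "rep (B \<odot> A) (B \<odot> D) X (\<alpha> X B D \<cdot> (\<sigma> B X \<otimes> \<one> D) \<cdot> dag (\<alpha> B X D) \<cdot> (\<one> B \<otimes> g))"
  using assms by (simp add: rep_def)

lemma whisker_left_cls:
  assumes "rep A D X g" "B \<in> Obj C"
  shows "whisker_left B (cls A D X g)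
    = cls (B \<odot> A) (B \<odot> D) X (\<alpha> X B D \<cdot> (\<sigma> B X \<otimes> \<one> D) \<cdot> dag (\<alpha> B X D) \<cdot> (\<one> B \<otimes> g))"
proof -
  have g: "A \<in> Obj C" "D \<in> Obj C" "X \<in> Obj C" "g \<in> Arr C" "Dom C g = A" "Cod C g = X \<odot> D"
    using assms(1) by (auto simp: rep_def)
  have "whisker_left B (cls A D X g)
      = cls (B \<odot> A) (B \<odot> D) X ((\<one> X \<otimes> dag (\<sigma> B D)) \<cdot> (\<alpha> X D B \<cdot> (g \<otimes> \<one> B)) \<cdot> \<sigma> B A)"
    using assms g by (simp add: whisker_left_def whisker_cls cls_comp_emb emb_comp_cls rep_def)
  also have "(\<one> X \<otimes> dag (\<sigma> B D)) \<cdot> (\<alpha> X D B \<cdot> (g \<otimes> \<one> B)) \<cdot> \<sigma> B A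
      = \<alpha> X B D \<cdot> (\<sigma> B X \<otimes> \<one> D) \<cdot> dag (\<alpha> B X D) \<cdot> (\<one> B \<otimes> g)"
    using g assms whisker_left_rep [of g X D A B] by simp
  finally show ?thesis .
qed

section \<open>The tensor of classes as a composite of whiskerings\<close>

lemma rep_tensor [simp]:
  assumes "rep A B X f" "rep A' D W g"
  shows "rep (A \<odot> A') (B \<odot> D) (X \<odot> W) (mid X B W D \<cdot> (f \<otimes> g))"
  using assms by (simp add: rep_def)

lemma tensor_cls_eq:
  assumes "rep A B X f" "rep A' D W g"
  shows "cls (A \<odot> A') (B \<odot> D) (X \<odot> W) (mid X B W D \<cdot> (f \<otimes> g))
    = whisker_left B (cls A' D W g) \<cdot>\<^bsub>CP\<^esub> whisker A' (cls A B X f)"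
proof -
  have o: "A' \<in> Obj C" "B \<in> Obj C" using assms by (auto simp: rep_def)
  show ?thesis
    unfolding whisker_left_cls [OF assms(2) o(2)] whisker_cls [OF assms(1) o(1)]
      cls_comp [OF rep_whisker [OF assms(1) o(1)] rep_whisker_left [OF assms(2) o(2)]]
    using tensor_rep [of f X B g W D A'] assms by (simp add: rep_def)
qed

lemma whisker_swap_cls:
  assumes "rep A B X f" "rep A' D W g"
  shows "whisker_left B (cls A' D W g) \<cdot>\<^bsub>CP\<^esub> whisker A' (cls A B X f)
    = whisker D (cls A B X f) \<cdot>\<^bsub>CP\<^esub> whisker_left A (cls A' D W g)"
proof -
  have o: "A' \<in> Obj C" "B \<in> Obj C" "A \<in> Obj C" "D \<in> Obj C" using assms by (auto simp: rep_def)
  have "whisker D (cls A B X f) \<cdot>\<^bsub>CP\<^esub> whisker_left A (cls A' D W g)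
      = cls (A \<odot> A') (B \<odot> D) (W \<odot> X) ((\<sigma> X W \<otimes> \<one> (B \<odot> D)) \<cdot> mid X B W D \<cdot> (f \<otimes> g))"
    unfolding whisker_left_cls [OF assms(2) o(3)] whisker_cls [OF assms(1) o(4)]
      cls_comp [OF rep_whisker_left [OF assms(2) o(3)] rep_whisker [OF assms(1) o(4)]]
    using tensor_swap_rep [of f X B A g W D] assms by (simp add: rep_def)
  also have "\<dots> = cls (A \<odot> A') (B \<odot> D) (X \<odot> W) (mid X B W D \<cdot> (f \<otimes> g))"
    \<comment> \<open>The isometry is \<open>\<sigma> X W\<close>, which exchanges the two
      ancillas.\<close>
    by (rule cls_isometry(2)) (use assms in \<open>simp_all add: rep_def\<close>)
  finally show ?thesis
    using tensor_cls_eq [OF assms] by simp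
qed

lemma whisker_swap:
  assumes "a \<in> Arr CP" "b \<in> Arr CP" "Dom CP a = A" "Cod CP a = B" "Dom CP b = A'" "Cod CP b = D"
  shows "whisker_left B b \<cdot>\<^bsub>CP\<^esub> whisker A' a = whisker D a \<cdot>\<^bsub>CP\<^esub> whisker_left A b"
  using Arr_CP_cases [OF assms(1)] Arr_CP_cases [OF assms(2)] assms(3-) whisker_swap_cls by metis

text \<open>The composite of whiskerings in \<open>tensor_cls_eq\<close> mentions only the classes,
  so all pairs of representatives give the same result and the tensor is well defined.\<close>

lemma tensor_cls:
  assumes "rep A B X f" "rep A' D W g"
  shows "cls A B X f \<otimes>\<^bsub>CP\<^esub> cls A' D W g
    = whisker_left B (cls A' D W g) \<cdot>\<^bsub>CP\<^esub> whisker A' (cls A B X f)"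
proof -
  have "cls (A \<odot> A') (B \<odot> D) (Z \<odot> Z') (mid Z B Z' D \<cdot> (h \<otimes> h'))
      = whisker_left B (cls A' D W g) \<cdot>\<^bsub>CP\<^esub> whisker A' (cls A B X f)"
    if "rep A B Z h" "rep A' D Z' h'" "cls A B Z h = cls A B X f" "cls A' D Z' h' = cls A' D W g"
    for Z h Z' h'
    using that by (simp add: tensor_cls_eq)
  note * = UN_rel_eq_cls [OF assms, where \<phi> = "\<lambda>X Y. X \<odot> Y" and
      \<psi> = "\<lambda>X f Y g. mid X B Y D \<cdot> (f \<otimes> g)", OF this]
  then show ?thesis
    by (simp add: CP_inf_def cp_tensor_def cp_class_def)
qed

lemma tensor_eq:
  assumes "a \<in> Arr CP" "b \<in> Arr CP"
  shows "a \<otimes>\<^bsub>CP\<^esub> b = whisker_left (Cod CP a) b \<cdot>\<^bsub>CP\<^esub> whisker (Dom CP b) a"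
  using Arr_CP_cases [OF assms(1)] Arr_CP_cases [OF assms(2)] tensor_cls by metis

subsection \<open>The monoidal structure and the environment\<close>

lemma CP_coherence [simp]:
  "\<alpha>\<^bsub>CP\<^esub> A B D = emb (\<alpha> A B D)" "\<l>\<^bsub>CP\<^esub> A = emb (\<l> A)" "\<r>\<^bsub>CP\<^esub> A = emb (\<r> A)"
  by (simp_all add: CP_inf_def)

lemma tensor_Arr [simp]:
  assumes "a \<in> Arr CP" "b \<in> Arr CP"
  shows "a \<otimes>\<^bsub>CP\<^esub> b \<in> Arr CP" "Dom CP (a \<otimes>\<^bsub>CP\<^esub> b) = Dom CP a \<odot> Dom CP b"
    "Cod CP (a \<otimes>\<^bsub>CP\<^esub> b) = Cod CP a \<odot> Cod CP b"
  using assms by (simp_all add: tensor_eq)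

lemma tensor_emb [simp]:
  assumes "u \<in> Arr C" "v \<in> Arr C"
  shows "emb u \<otimes>\<^bsub>CP\<^esub> emb v = emb (u \<otimes> v)"
  using assms by (simp add: tensor_eq)

lemma iso_emb:
  assumes "unitary C dag u"
  shows "iso CP (emb u)"
proof -
  have "u \<in> Arr C" using assms by (simp add: unitary_def inverse_arrows_def)
  then have "inverse_arrows CP (emb u) (emb (dag u))"
    using assms by (simp add: unitary_cancel inverse_arrows_def CP_Ident)
  then show ?thesis
    unfolding iso_def by blast
qed

section \<open>Naturality of the associator and of the left unitor\<close>

lemma assoc_whisker:
  assumes "a \<in> Arr CP" "B \<in> Obj C" "D \<in> Obj C" "Dom CP a = A" "Cod CP a = A'"
  shows "emb (\<alpha> A' B D) \<cdot>\<^bsub>CP\<^esub> whisker D (whisker B a) = whisker (B \<odot> D) a \<cdot>\<^bsub>CP\<^esub> emb (\<alpha> A B D)"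
  using assms Arr_CP_Obj [OF assms(1)] by (simp add: whisker_whisker)

text \<open>Expanded, the two sides whisker \<open>b\<close> by \<open>A \<odot> D\<close> and by
  \<open>D \<odot> A\<close>. Sliding \<open>\<sigma> A D\<close> through \<open>b\<close> relates
  them, and the first hexagon, at \<open>B\<close> and in dagger form at \<open>B'\<close>, matches
  the remaining coherence maps.\<close>

lemma assoc_whisker_whisker_left:
  assumes "b \<in> Arr CP" "A \<in> Obj C" "D \<in> Obj C" "Dom CP b = B" "Cod CP b = B'"
  shows "emb (\<alpha> A B' D) \<cdot>\<^bsub>CP\<^esub> whisker D (whisker_left A b)
    = whisker_left A (whisker D b) \<cdot>\<^bsub>CP\<^esub> emb (\<alpha> A B D)"
proof -
  have o: "B \<in> Obj C" "B' \<in> Obj C" using Arr_CP_Obj [OF assms(1)] assms by auto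
  have hex: "\<alpha> B D A \<cdot> \<sigma> A (B \<odot> D) \<cdot> \<alpha> A B D = (\<one> B \<otimes> \<sigma> A D) \<cdot> \<alpha> B A D \<cdot> (\<sigma> A B \<otimes> \<one> D)"
    using hexagon1 assms o by simp
  have "\<alpha> A B' D \<cdot> (dag (\<sigma> A B') \<otimes> \<one> D) \<cdot> dag (\<alpha> B' A D)
      = \<alpha> A B' D \<cdot> dag ((\<one> B' \<otimes> \<sigma> A D) \<cdot> \<alpha> B' A D \<cdot> (\<sigma> A B' \<otimes> \<one> D)) \<cdot> (\<one> B' \<otimes> \<sigma> A D)"
    using assms o by simp
  also have "\<dots> = dag (\<sigma> A (B' \<odot> D)) \<cdot> dag (\<alpha> B' D A) \<cdot> (\<one> B' \<otimes> \<sigma> A D)"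
    unfolding hexagon1 [OF assms(2) o(2) assms(3), symmetric] using assms o by simp
  finally have hex': "\<alpha> A B' D \<cdot> (dag (\<sigma> A B') \<otimes> \<one> D) \<cdot> dag (\<alpha> B' A D) = \<dots>" .
  have "whisker_left A (whisker D b) \<cdot>\<^bsub>CP\<^esub> emb (\<alpha> A B D)
      = emb (dag (\<sigma> A (B' \<odot> D)) \<cdot> dag (\<alpha> B' D A)) \<cdot>\<^bsub>CP\<^esub> whisker (D \<odot> A) b
        \<cdot>\<^bsub>CP\<^esub> emb (\<alpha> B D A \<cdot> \<sigma> A (B \<odot> D) \<cdot> \<alpha> A B D)"
    using assms o by (simp add: whisker_left_def whisker_whisker)
  also have "\<dots> = emb (dag (\<sigma> A (B' \<odot> D)) \<cdot> dag (\<alpha> B' D A)) \<cdot>\<^bsub>CP\<^esub>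
      (whisker (D \<odot> A) b \<cdot>\<^bsub>CP\<^esub> emb (\<one> B \<otimes> \<sigma> A D)) \<cdot>\<^bsub>CP\<^esub> emb (\<alpha> B A D \<cdot> (\<sigma> A B \<otimes> \<one> D))"
    unfolding hex using assms o by simp
  also have "\<dots> = emb (dag (\<sigma> A (B' \<odot> D)) \<cdot> dag (\<alpha> B' D A) \<cdot> (\<one> B' \<otimes> \<sigma> A D)) \<cdot>\<^bsub>CP\<^esub> whisker (A \<odot> D) b
      \<cdot>\<^bsub>CP\<^esub> emb (\<alpha> B A D \<cdot> (\<sigma> A B \<otimes> \<one> D))"
    using assms o by (subst whisker_slide [where W = "A \<odot> D" and B = B']) simp_all
  also have "\<dots> = emb (\<alpha> A B' D) \<cdot>\<^bsub>CP\<^esub> whisker D (whisker_left A b)"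
    unfolding hex' [symmetric] using assms o by (simp add: whisker_left_def whisker_whisker)
  finally show ?thesis ..
qed

text \<open>Both sides reverse the order of three factors; this is a form of the Yang-Baxter
  equation, obtained from naturality of the braiding and both hexagons.\<close>

lemma braid_reverse:
  assumes "A \<in> Obj C" "B \<in> Obj C" "D \<in> Obj C"
  shows "\<alpha> D B A \<cdot> (\<sigma> B D \<otimes> \<one> A) \<cdot> \<sigma> A (B \<odot> D) \<cdot> \<alpha> A B D = (\<one> D \<otimes> \<sigma> A B) \<cdot> \<sigma> (A \<odot> B) D"
proof -
  have "\<alpha> D B A \<cdot> (\<sigma> B D \<otimes> \<one> A) \<cdot> \<sigma> A (B \<odot> D) \<cdot> \<alpha> A B D
      = \<alpha> D B A \<cdot> ((\<sigma> B D \<otimes> \<one> A) \<cdot> \<sigma> A (B \<odot> D)) \<cdot> \<alpha> A B D"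
    using assms by simp
  also have "(\<sigma> B D \<otimes> \<one> A) \<cdot> \<sigma> A (B \<odot> D) = \<sigma> A (D \<odot> B) \<cdot> (\<one> A \<otimes> \<sigma> B D)"
    using assms braid_nat [of "\<one> A" "\<sigma> B D" A "D \<odot> B"] by simp
  also have "\<alpha> D B A \<cdot> (\<sigma> A (D \<odot> B) \<cdot> (\<one> A \<otimes> \<sigma> B D)) \<cdot> \<alpha> A B D
      = (\<alpha> D B A \<cdot> \<sigma> A (D \<odot> B)) \<cdot> (\<one> A \<otimes> \<sigma> B D) \<cdot> \<alpha> A B D"
    using assms by simp
  also have "\<dots> = (\<one> D \<otimes> \<sigma> A B) \<cdot> \<alpha> D A B \<cdot>
      ((\<sigma> A D \<otimes> \<one> B) \<cdot> dag (\<alpha> A D B) \<cdot> (\<one> A \<otimes> \<sigma> B D) \<cdot> \<alpha> A B D)"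
    unfolding hexagon1_dag [OF assms(1,3,2)] using assms by simp
  also have "\<dots> = (\<one> D \<otimes> \<sigma> A B) \<cdot> \<sigma> (A \<odot> B) D"
    unfolding hexagon2_dag [OF assms, symmetric] using assms by simp
  finally show ?thesis .
qed

text \<open>Two left whiskerings become a right whiskering by \<open>B \<odot> A\<close>, the single
  one by \<open>A \<odot> B\<close>. Here \<open>\<sigma> A B\<close> slides through
  \<open>c\<close>, and \<open>braid_reverse\<close> plays the part of the hexagon.\<close>

lemma assoc_whisker_left:
  assumes "c \<in> Arr CP" "A \<in> Obj C" "B \<in> Obj C" "Dom CP c = D" "Cod CP c = D'"
  shows "emb (\<alpha> A B D') \<cdot>\<^bsub>CP\<^esub> whisker_left (A \<odot> B) c
    = whisker_left A (whisker_left B c) \<cdot>\<^bsub>CP\<^esub> emb (\<alpha> A B D)"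
proof -
  have o: "D \<in> Obj C" "D' \<in> Obj C" using Arr_CP_Obj [OF assms(1)] assms by auto
  have "\<alpha> A B D' \<cdot> dag (\<sigma> (A \<odot> B) D')
      = \<alpha> A B D' \<cdot> dag ((\<one> D' \<otimes> \<sigma> A B) \<cdot> \<sigma> (A \<odot> B) D') \<cdot> (\<one> D' \<otimes> \<sigma> A B)"
    using assms o by simp
  also have "\<dots> = dag (\<sigma> A (B \<odot> D')) \<cdot> (dag (\<sigma> B D') \<otimes> \<one> A) \<cdot> dag (\<alpha> D' B A) \<cdot> (\<one> D' \<otimes> \<sigma> A B)"
    unfolding braid_reverse [OF assms(2,3) o(2), symmetric] using assms o by simp
  finally have rev': "\<alpha> A B D' \<cdot> dag (\<sigma> (A \<odot> B) D') = \<dots>" .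
  have "whisker_left A (whisker_left B c) \<cdot>\<^bsub>CP\<^esub> emb (\<alpha> A B D)
      = emb (dag (\<sigma> A (B \<odot> D')) \<cdot> (dag (\<sigma> B D') \<otimes> \<one> A) \<cdot> dag (\<alpha> D' B A)) \<cdot>\<^bsub>CP\<^esub> whisker (B \<odot> A) c
        \<cdot>\<^bsub>CP\<^esub> emb (\<alpha> D B A \<cdot> (\<sigma> B D \<otimes> \<one> A) \<cdot> \<sigma> A (B \<odot> D) \<cdot> \<alpha> A B D)"
    using assms o by (simp add: whisker_left_def whisker_whisker)
  also have "\<dots> = emb (dag (\<sigma> A (B \<odot> D')) \<cdot> (dag (\<sigma> B D') \<otimes> \<one> A) \<cdot> dag (\<alpha> D' B A)) \<cdot>\<^bsub>CP\<^esub>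
      (whisker (B \<odot> A) c \<cdot>\<^bsub>CP\<^esub> emb (\<one> D \<otimes> \<sigma> A B)) \<cdot>\<^bsub>CP\<^esub> emb (\<sigma> (A \<odot> B) D)"
    unfolding braid_reverse [OF assms(2,3) o(1)] using assms o by simp
  also have "\<dots> = emb (dag (\<sigma> A (B \<odot> D')) \<cdot> (dag (\<sigma> B D') \<otimes> \<one> A) \<cdot> dag (\<alpha> D' B A) \<cdot> (\<one> D' \<otimes> \<sigma> A B))
      \<cdot>\<^bsub>CP\<^esub> whisker (A \<odot> B) c \<cdot>\<^bsub>CP\<^esub> emb (\<sigma> (A \<odot> B) D)"
    using assms o by (subst whisker_slide [where W = "A \<odot> B" and B = D']) simp_all
  also have "\<dots> = emb (\<alpha> A B D') \<cdot>\<^bsub>CP\<^esub> whisker_left (A \<odot> B) c"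
    unfolding rev' [symmetric] using assms o by (simp add: whisker_left_def)
  finally show ?thesis ..
qed

text \<open>On a representative both composites agree up to the ancilla unitary found in
  \<open>LUnit_whisker_rep\<close>.\<close>

lemma LUnit_whisker_left:
  assumes "a \<in> Arr CP" "Dom CP a = A" "Cod CP a = B"
  shows "emb (\<l> B) \<cdot>\<^bsub>CP\<^esub> whisker_left \<I> a = a \<cdot>\<^bsub>CP\<^esub> emb (\<l> A)"
proof -
  obtain W g where r: "rep A B W g" and a: "a = cls A B W g"
    using Arr_CP_cases [OF assms(1)] assms by metis
  have g: "A \<in> Obj C" "B \<in> Obj C" "W \<in> Obj C" "g \<in> Arr C" "Dom C g = A" "Cod C g = W \<odot> B"
    using r by (auto simp: rep_def)
  have "emb (\<l> B) \<cdot>\<^bsub>CP\<^esub> whisker_left \<I> a = cls (\<I> \<odot> A) B W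
      ((\<one> W \<otimes> \<l> B) \<cdot> \<alpha> W \<I> B \<cdot> (\<sigma> \<I> W \<otimes> \<one> B) \<cdot> dag (\<alpha> \<I> W B) \<cdot> (\<one> \<I> \<otimes> g))"
    unfolding a whisker_left_cls [OF r Unit_Obj]
    by (rule emb_comp_cls) (use r g rep_whisker_left [OF r Unit_Obj] in simp_all)
  also have "\<dots> = cls (\<I> \<odot> A) B W (g \<cdot> \<l> A)"
    unfolding LUnit_whisker_rep [OF g(4,6,5,3,2)]
    by (rule cls_isometry(2)) (use r g in \<open>simp_all add: rep_def\<close>)
  also have "\<dots> = a \<cdot>\<^bsub>CP\<^esub> emb (\<l> A)"
    unfolding a by (rule cls_comp_emb [symmetric]) (use r g in simp_all)
  finally show ?thesis .
qed

text \<open>Each iterated tensor is a composite of one whiskering each of \<open>a\<close>,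
  \<open>b\<close> and \<open>c\<close>. The associator is carried past \<open>c\<close>, then
  \<open>b\<close>, then \<open>a\<close>, one lemma for each position.\<close>

lemma CP_Assoc_natural:
  assumes "a \<in> Arr CP" "b \<in> Arr CP" "c \<in> Arr CP"
    "Dom CP a = A" "Cod CP a = A'" "Dom CP b = B" "Cod CP b = B'" "Dom CP c = D" "Cod CP c = D'"
  shows "emb (\<alpha> A' B' D') \<cdot>\<^bsub>CP\<^esub> ((a \<otimes>\<^bsub>CP\<^esub> b) \<otimes>\<^bsub>CP\<^esub> c)
    = (a \<otimes>\<^bsub>CP\<^esub> (b \<otimes>\<^bsub>CP\<^esub> c)) \<cdot>\<^bsub>CP\<^esub> emb (\<alpha> A B D)"
proof -
  have o: "A \<in> Obj C" "A' \<in> Obj C" "B \<in> Obj C" "B' \<in> Obj C" "D \<in> Obj C" "D' \<in> Obj C"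
    using assms Arr_CP_Obj by blast+
  have "emb (\<alpha> A' B' D') \<cdot>\<^bsub>CP\<^esub> ((a \<otimes>\<^bsub>CP\<^esub> b) \<otimes>\<^bsub>CP\<^esub> c)
      = (emb (\<alpha> A' B' D') \<cdot>\<^bsub>CP\<^esub> whisker_left (A' \<odot> B') c) \<cdot>\<^bsub>CP\<^esub>
        whisker D (whisker_left A' b) \<cdot>\<^bsub>CP\<^esub> whisker D (whisker B a)"
    using assms o by (simp add: tensor_eq)
  also have "\<dots> = whisker_left A' (whisker_left B' c) \<cdot>\<^bsub>CP\<^esub>
      (emb (\<alpha> A' B' D) \<cdot>\<^bsub>CP\<^esub> whisker D (whisker_left A' b)) \<cdot>\<^bsub>CP\<^esub> whisker D (whisker B a)"
    using assms o by (simp add: assoc_whisker_left)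
  also have "\<dots> = whisker_left A' (whisker_left B' c) \<cdot>\<^bsub>CP\<^esub> whisker_left A' (whisker D b) \<cdot>\<^bsub>CP\<^esub>
      (emb (\<alpha> A' B D) \<cdot>\<^bsub>CP\<^esub> whisker D (whisker B a))"
    using assms o by (simp add: assoc_whisker_whisker_left)
  also have "\<dots> = (a \<otimes>\<^bsub>CP\<^esub> (b \<otimes>\<^bsub>CP\<^esub> c)) \<cdot>\<^bsub>CP\<^esub> emb (\<alpha> A B D)"
    using assms o by (simp add: assoc_whisker tensor_eq)
  finally show ?thesis .
qed

text \<open>Functoriality of whiskering leaves only the two middle factors in the wrong order, and
  \<open>whisker_swap\<close> exchanges them.\<close>

lemma CP_interchange:
  assumes "f \<in> Arr CP" "g \<in> Arr CP" "f' \<in> Arr CP" "g' \<in> Arr CP" "Dom CP g = Cod CP f" "Dom CP g' = Cod CP f'"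
  shows "(g \<cdot>\<^bsub>CP\<^esub> f) \<otimes>\<^bsub>CP\<^esub> (g' \<cdot>\<^bsub>CP\<^esub> f') = (g \<otimes>\<^bsub>CP\<^esub> g') \<cdot>\<^bsub>CP\<^esub> (f \<otimes>\<^bsub>CP\<^esub> f')"
proof -
  have "(g \<cdot>\<^bsub>CP\<^esub> f) \<otimes>\<^bsub>CP\<^esub> (g' \<cdot>\<^bsub>CP\<^esub> f') = whisker_left (Cod CP g) g' \<cdot>\<^bsub>CP\<^esub>
      (whisker_left (Cod CP g) f' \<cdot>\<^bsub>CP\<^esub> whisker (Dom CP f') g) \<cdot>\<^bsub>CP\<^esub> whisker (Dom CP f') f"
    using assms by (simp add: tensor_eq)
  also have "\<dots> = whisker_left (Cod CP g) g' \<cdot>\<^bsub>CP\<^esub>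
      (whisker (Cod CP f') g \<cdot>\<^bsub>CP\<^esub> whisker_left (Cod CP f) f') \<cdot>\<^bsub>CP\<^esub> whisker (Dom CP f') f"
    using whisker_swap [of g f'] assms by simp
  also have "\<dots> = (g \<otimes>\<^bsub>CP\<^esub> g') \<cdot>\<^bsub>CP\<^esub> (f \<otimes>\<^bsub>CP\<^esub> f')"
    using assms by (simp add: tensor_eq)
  finally show ?thesis .
qed

lemma monoidal_category_CP: "monoidal_category CP"
proof
  show "iso CP (\<alpha>\<^bsub>CP\<^esub> A B D)" if "A \<in> Obj CP" "B \<in> Obj CP" "D \<in> Obj CP" for A B D
    using that by (simp add: iso_emb Assoc_unitary)
  show "iso CP (\<l>\<^bsub>CP\<^esub> A)" "iso CP (\<r>\<^bsub>CP\<^esub> A)" if "A \<in> Obj CP" for A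
    using that by (simp_all add: iso_emb LUnit_unitary RUnit_unitary)
  show "(g \<cdot>\<^bsub>CP\<^esub> f) \<otimes>\<^bsub>CP\<^esub> (g' \<cdot>\<^bsub>CP\<^esub> f') = (g \<otimes>\<^bsub>CP\<^esub> g') \<cdot>\<^bsub>CP\<^esub> (f \<otimes>\<^bsub>CP\<^esub> f')"
    if "f \<in> hom CP A B" "g \<in> hom CP B D" "f' \<in> hom CP A' B'" "g' \<in> hom CP B' D'"
    for f g f' g' A B D A' B' D'
    using that by (simp add: CP_interchange)
  show "\<alpha>\<^bsub>CP\<^esub> A' B' D' \<cdot>\<^bsub>CP\<^esub> ((f \<otimes>\<^bsub>CP\<^esub> g) \<otimes>\<^bsub>CP\<^esub> h)
      = (f \<otimes>\<^bsub>CP\<^esub> (g \<otimes>\<^bsub>CP\<^esub> h)) \<cdot>\<^bsub>CP\<^esub> \<alpha>\<^bsub>CP\<^esub> A B D"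
    if "f \<in> hom CP A A'" "g \<in> hom CP B B'" "h \<in> hom CP D D'" for f g h A A' B B' D D'
    using that CP_Assoc_natural [of f g h] by simp
  show "\<l>\<^bsub>CP\<^esub> B \<cdot>\<^bsub>CP\<^esub> (\<one>\<^bsub>CP\<^esub> \<I>\<^bsub>CP\<^esub> \<otimes>\<^bsub>CP\<^esub> f) = f \<cdot>\<^bsub>CP\<^esub> \<l>\<^bsub>CP\<^esub> A" if "f \<in> hom CP A B" for f A B
    using that LUnit_whisker_left [of f A B] by (auto simp: CP_Ident tensor_eq)
  show "\<r>\<^bsub>CP\<^esub> B \<cdot>\<^bsub>CP\<^esub> (f \<otimes>\<^bsub>CP\<^esub> \<one>\<^bsub>CP\<^esub> \<I>\<^bsub>CP\<^esub>) = f \<cdot>\<^bsub>CP\<^esub> \<r>\<^bsub>CP\<^esub> A" if "f \<in> hom CP A B" for f A B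
    using that whisker_Unit [of f A B] by (auto simp: CP_Ident tensor_eq)
\<comment> \<open>Pentagon and triangle involve embedded arrows only, and \<open>emb\<close>
  preserves composites and tensors, so they are inherited from \<open>C\<close>.\<close>
qed (auto simp: CP_Ident pentagon triangle)

lemma strict_monoidal_functor_emb: "strict_monoidal_functor C CP (\<lambda>A. A) emb"
proof -
  interpret CP: monoidal_category CP by (rule monoidal_category_CP)
  show ?thesis
    by unfold_locales (auto simp: CP_Ident)
qed

text \<open>A unitary \<open>v : A \<rightarrow> A \<odot> \<I>\<close> differs from \<open>dag (\<r> A)\<close> by the unitary \<open>\<r> A \<cdot> v\<close> on the ancilla.\<close>

lemma cls_unitary_eq_top:
  assumes "v \<in> Arr C" "Dom C v = A" "Cod C v = A \<odot> \<I>" "dag v \<cdot> v = \<one> A"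
  shows "cls A \<I> A v = cls A \<I> A (dag (\<r> A))"
proof -
  have A: "A \<in> Obj C" using assms by auto
  have "v = dag (\<r> A) \<cdot> \<r> A \<cdot> ((\<r> A \<cdot> v) \<otimes> \<one> \<I>) \<cdot> dag (\<r> A)"
    using assms A Comp_reassoc [OF RUnit_nat [of "\<r> A \<cdot> v" A], of "dag (\<r> A)"] by simp
  also have "\<dots> = ((\<r> A \<cdot> v) \<otimes> \<one> \<I>) \<cdot> dag (\<r> A)"
    using assms A by simp
  finally have "v = ((\<r> A \<cdot> v) \<otimes> \<one> \<I>) \<cdot> dag (\<r> A)" .
  moreover have "cls A \<I> A (((\<r> A \<cdot> v) \<otimes> \<one> \<I>) \<cdot> dag (\<r> A)) = cls A \<I> A (dag (\<r> A))"
    by (rule cls_isometry(2)) (use assms A in \<open>simp_all add: rep_def\<close>)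
  ultimately show ?thesis by simp
qed

section \<open>Discarding maps and the environment axioms\<close>

abbreviation discard :: "'o \<Rightarrow> ('o, 'm) cp_arr" where
  "discard A \<equiv> cls A \<I> A (dag (\<r> A))"

lemma rep_discard [simp]: "A \<in> Obj C \<Longrightarrow> rep A \<I> A (dag (\<r> A))"
  by (simp add: rep_def)

text \<open>By the triangle the coherence maps cancel, and discarding a factor amounts to declaring
  it the ancilla of an identity arrow.\<close>

lemma LUnit_whisker_discard:
  assumes "X \<in> Obj C" "B \<in> Obj C"
  shows "emb (\<l> B) \<cdot>\<^bsub>CP\<^esub> whisker B (discard X) = cls (X \<odot> B) B X (\<one> (X \<odot> B))"
proof -
  have "(\<one> X \<otimes> \<l> B) \<cdot> \<alpha> X \<I> B \<cdot> (dag (\<r> X) \<otimes> \<one> B)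
      = ((\<one> X \<otimes> \<l> B) \<cdot> \<alpha> X \<I> B) \<cdot> (dag (\<r> X) \<otimes> \<one> B)"
    using assms by simp
  also have "\<dots> = \<one> (X \<odot> B)"
    unfolding triangle [OF assms] using assms by simp
  finally have *: "(\<one> X \<otimes> \<l> B) \<cdot> \<alpha> X \<I> B \<cdot> (dag (\<r> X) \<otimes> \<one> B) = \<one> (X \<odot> B)" .
  show ?thesis
    unfolding whisker_cls [OF rep_discard [OF assms(1)] assms(2)]
    using emb_comp_cls [OF rep_whisker [OF rep_discard [OF assms(1)] assms(2)], of "\<l> B" B] assms *
    by simp
qed

text \<open>Precomposing the class of \<open>\<one> (X \<odot> B)\<close> with \<open>f\<close>
  makes \<open>f\<close> itself the representative. Environment axioms (b) and (c) are both read off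
  from this.\<close>

lemma purify:
  assumes "rep A B X f"
  shows "emb (\<l> B) \<cdot>\<^bsub>CP\<^esub> (discard X \<otimes>\<^bsub>CP\<^esub> \<one>\<^bsub>CP\<^esub> B) \<cdot>\<^bsub>CP\<^esub> emb f = cls A B X f"
proof -
  have f: "A \<in> Obj C" "B \<in> Obj C" "X \<in> Obj C" "f \<in> Arr C" "Dom C f = A" "Cod C f = X \<odot> B"
    using assms by (auto simp: rep_def)
  have "emb (\<l> B) \<cdot>\<^bsub>CP\<^esub> (discard X \<otimes>\<^bsub>CP\<^esub> \<one>\<^bsub>CP\<^esub> B) \<cdot>\<^bsub>CP\<^esub> emb f
      = (emb (\<l> B) \<cdot>\<^bsub>CP\<^esub> whisker B (discard X)) \<cdot>\<^bsub>CP\<^esub> emb f"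
    using f by (simp add: tensor_eq CP_Ident)
  also have "\<dots> = cls A B X (\<one> (X \<odot> B) \<cdot> f)"
    unfolding LUnit_whisker_discard [OF f(3,2)]
    by (rule cls_comp_emb) (use f in \<open>simp_all add: rep_def\<close>)
  finally show ?thesis
    using f by simp
qed

lemma discard_tensor:
  assumes "A \<in> Obj C" "B \<in> Obj C"
  shows "emb (\<l> \<I>) \<cdot>\<^bsub>CP\<^esub> (discard A \<otimes>\<^bsub>CP\<^esub> discard B) = discard (A \<odot> B)"
proof -
  have "emb (\<l> \<I>) \<cdot>\<^bsub>CP\<^esub> (discard A \<otimes>\<^bsub>CP\<^esub> discard B)
      = (emb (\<l> \<I>) \<cdot>\<^bsub>CP\<^esub> whisker_left \<I> (discard B)) \<cdot>\<^bsub>CP\<^esub> whisker B (discard A)"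
    using assms by (simp add: tensor_eq)
  also have "\<dots> = discard B \<cdot>\<^bsub>CP\<^esub> (emb (\<l> B) \<cdot>\<^bsub>CP\<^esub> whisker B (discard A))"
    using assms by (subst LUnit_whisker_left [where A = B]) simp_all
  also have "\<dots> = cls (A \<odot> B) \<I> (A \<odot> B) (dag (\<alpha> A B \<I>) \<cdot> (\<one> A \<otimes> dag (\<r> B)) \<cdot> \<one> (A \<odot> B))"
    unfolding LUnit_whisker_discard [OF assms] by (rule cls_comp) (use assms in \<open>simp_all add: rep_def\<close>)
  also have "\<dots> = discard (A \<odot> B)"
    \<comment> \<open>The representative is a unitary from \<open>A \<odot> B\<close> to
      \<open>(A \<odot> B) \<odot> \<I>\<close>, hence equivalent to
      \<open>dag (\<r> (A \<odot> B))\<close>.\<close>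
    by (rule cls_unitary_eq_top) (use assms in simp_all)
  finally show ?thesis .
qed

text \<open>The two sides are represented by the unitaries \<open>dag (\<r> \<I>)\<close> and
  \<open>dag (\<l> \<I>)\<close> with the same ancilla, which \<open>cls_unitary_eq_top\<close>
  identifies.\<close>

lemma discard_Unit: "discard \<I> = \<one>\<^bsub>CP\<^esub> \<I>"
  using cls_unitary_eq_top [of "dag (\<l> \<I>)" \<I>] by (simp add: CP_Ident cp_embed_def)

end

theorem theorem16:
  fixes C :: "('o, 'm, 'z) monoidal_structure_scheme"
    and dag :: "'m \<Rightarrow> 'm"
    and \<sigma> :: "'o \<Rightarrow> 'o \<Rightarrow> 'm"
  assumes "dagger_braided_monoidal_category C dag \<sigma>"
  shows "environment_structure C dag (CP_inf C dag \<sigma>)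
           (\<lambda>A. A)
           (\<lambda>f. cp_class C dag (Dom C f) (Cod C f) \<I>\<^bsub>C\<^esub> (dag (\<l>\<^bsub>C\<^esub> (Cod C f)) \<cdot>\<^bsub>C\<^esub> f))
           (\<lambda>A. cp_class C dag A \<I>\<^bsub>C\<^esub> A (dag (\<r>\<^bsub>C\<^esub> A)))"
proof -
  interpret dagger_braided_monoidal_category C dag \<sigma> by fact
  interpret F: strict_monoidal_functor C CP "\<lambda>A. A" emb by (rule strict_monoidal_functor_emb)
  have "environment_structure C dag CP (\<lambda>A. A) emb discard"
  proof
    show "discard A \<in> hom CP A \<I>\<^bsub>CP\<^esub>" if "A \<in> Obj C" for A
      using that by simp
    show "\<l>\<^bsub>CP\<^esub> \<I>\<^bsub>CP\<^esub> \<cdot>\<^bsub>CP\<^esub> (discard A \<otimes>\<^bsub>CP\<^esub> discard B) = discard (A \<odot>\<^bsub>CP\<^esub> B)"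
      if "A \<in> Obj C" "B \<in> Obj C" for A B
      using that by (simp add: discard_tensor)
    show "discard \<I>\<^bsub>CP\<^esub> = \<one>\<^bsub>CP\<^esub> \<I>\<^bsub>CP\<^esub>"
      by (simp add: discard_Unit)
    fix A B assume o: "A \<in> Obj C" "B \<in> Obj C"
    show "anc_equiv C dag B (X, f) (Y, g) \<longleftrightarrow>
        \<l>\<^bsub>CP\<^esub> B \<cdot>\<^bsub>CP\<^esub> (discard X \<otimes>\<^bsub>CP\<^esub> \<one>\<^bsub>CP\<^esub> B) \<cdot>\<^bsub>CP\<^esub> emb f =
        \<l>\<^bsub>CP\<^esub> B \<cdot>\<^bsub>CP\<^esub> (discard Y \<otimes>\<^bsub>CP\<^esub> \<one>\<^bsub>CP\<^esub> B) \<cdot>\<^bsub>CP\<^esub> emb g"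
      if "X \<in> Obj C" "Y \<in> Obj C" "f \<in> hom C A (X \<odot>\<^bsub>C\<^esub> B)" "g \<in> hom C A (Y \<odot>\<^bsub>C\<^esub> B)" for X Y f g
    proof -
      have r: "rep A B X f" "rep A B Y g" using o that by (auto simp: rep_def)
      show ?thesis
        \<comment> \<open>By \<open>purify\<close> the right side says that the classes of
          \<open>f\<close> and \<open>g\<close> coincide, which is the equivalence in terms of
          pulls.\<close>
        unfolding CP_coherence purify [OF r(1)] purify [OF r(2)] cls_eq_iff [OF r]
        by (rule anc_equiv_iff_pull) (use o that in auto)
    qed
    show "\<exists>X \<in> Obj C. \<exists>f \<in> hom C A (X \<odot>\<^bsub>C\<^esub> B).
        k = \<l>\<^bsub>CP\<^esub> B \<cdot>\<^bsub>CP\<^esub> (discard X \<otimes>\<^bsub>CP\<^esub> \<one>\<^bsub>CP\<^esub> B) \<cdot>\<^bsub>CP\<^esub> emb f"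
      if "k \<in> hom CP A B" for k
    proof -
      have k: "k \<in> Arr CP" "Dom CP k = A" "Cod CP k = B" using that by simp_all
      obtain X f where r: "rep A B X f" "k = cls A B X f"
        using Arr_CP_cases [OF k(1)] k(2,3) by auto
      \<comment> \<open>Any representative of \<open>k\<close> is a purification, with its ancilla
        as the discarded object.\<close>
      then show ?thesis
        using purify [OF r(1)] by (intro bexI [of _ X] bexI [of _ f]) (auto simp: rep_def)
    qed
  qed simp_all
  then show ?thesis
    unfolding cp_embed_def [abs_def] .
qed

end
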